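(* Let $\mu>0$ (mass), $\gamma>0$, $\boldsymbol r_0\in\mathbb{R}^2\setminus\{0\}$, and consider the Lagrangian system in the plane with Lagrangian $$L(\boldsymbol r,\dot{\boldsymbol r})=\frac{\mu}{2}|\dot{\boldsymbol r}|^2-V(\boldsymbol r),\qquad V(\boldsymbol r)=-\gamma\Big(\frac{1}{|\boldsymbol r-\boldsymbol r_0|^n}+\frac{1}{|\boldsymbol r+\boldsymbol r_0|^n}\Big),\qquad \boldsymbol r\in\mathbb{R}^2\setminus\{\boldsymbol r_0,-\boldsymbol r_0\}.$$ For any $\omega>0$, any $n\ge2$ and any $m\in\mathbb{N}$ ($m\geq 1$) this system has an $\omega$-periodic solution $\boldsymbol r(t)$ that first coils $m$ times clockwise about the point $\boldsymbol r_0$ and then coils $m$ times counterclockwise about the point $-\boldsymbol r_0$. If $m=1$, the solution $\boldsymbol r(t)$ forms an $8$-like curve in the plane.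
   Context: A solution is a $C^2$ function $\boldsymbol r:\mathbb{R}\to\mathbb{R}^2\setminus\{\pm\boldsymbol r_0\}$ satisfying the Euler–Lagrange equation $\mu\ddot{\boldsymbol r}=-\nabla V(\boldsymbol r)$; $|\cdot|$ is the Euclidean norm. Meaning of "coils": the statement is about the homotopy type of the closed curve. Let $\alpha$ be the loop based at $0$ that goes along the straight segment from $0$ towards $\boldsymbol r_0$, goes once clockwise around a small circle centered at $\boldsymbol r_0$, and returns to $0$ along the segment; let $\beta$ be the loop based at $0$ that goes along the straight segment from $0$ towards $-\boldsymbol r_0$, goes once counterclockwise around a small circle centered at $-\boldsymbol r_0$, and returns. That the $\omega$-periodic curve $\boldsymbol r$ first coils $m$ times clockwise about $\boldsymbol r_0$ and then $m$ times counterclockwise about $-\boldsymbol r_0$ means that $\boldsymbol r|_{[0,\omega]}$, as a closed curve, is homotopic through closed curves in $\mathbb{R}^2\setminus\{\pm\boldsymbol r_0\}$ to the concatenation of $m$ copies of $\alpha$ followed by $m$ copies of $\beta$. For $m=1$ this is the homotopy type of a figure-eight curve around the two points, which is the sense of "$8$-like curve". *)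

theory Defs
  imports "HOL-Analysis.Analysis"
begin

definition config_space :: "real^2 \<Rightarrow> (real^2) set" where
  "config_space r0 = - {r0, - r0}"

definition potential :: "real \<Rightarrow> real \<Rightarrow> real^2 \<Rightarrow> real^2 \<Rightarrow> real" where
  "potential \<gamma> n r0 x =
     - \<gamma> * (1 / norm (x - r0) powr n + 1 / norm (x + r0) powr n)"

text \<open>
  The Euler--Lagrange equation of the Lagrangian
  \<open>\<mu>/2 * (norm v)\<^sup>2 - V x\<close> on \<open>S\<close> is
  \<open>\<mu> *\<^sub>R a = - grad V x\<close>, with \<open>v\<close> and \<open>a\<close> the velocity and the acceleration.
\<close>

definition is_solution ::
  "real \<Rightarrow> (real^2 \<Rightarrow> real) \<Rightarrow> (real^2) set \<Rightarrow> (real \<Rightarrow> real^2) \<Rightarrow> bool" where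
  "is_solution \<mu> V S r \<longleftrightarrow>
     range r \<subseteq> S \<and>
     (\<exists>v a. (\<forall>t. (r has_vector_derivative v t) (at t)) \<and>
            (\<forall>t. (v has_vector_derivative a t) (at t)) \<and>
            continuous_on UNIV a \<and>
            (\<forall>t. \<exists>g. GDERIV V (r t) :> g \<and> \<mu> *\<^sub>R a t = - g))"

definition rotate_by :: "real \<Rightarrow> real^2 \<Rightarrow> real^2" where
  "rotate_by \<theta> x =
     vector [cos \<theta> * x$1 - sin \<theta> * x$2, sin \<theta> * x$1 + cos \<theta> * x$2]"

text \<open>
  \<open>circle_loop \<sigma> c a\<close> starts at \<open>a\<close> and goes once around the circle centred at \<open>c\<close>,
  counterclockwise for \<open>\<sigma> = 1\<close> and clockwise for \<open>\<sigma> = - 1\<close>.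
\<close>

definition circle_loop :: "real \<Rightarrow> real^2 \<Rightarrow> real^2 \<Rightarrow> real \<Rightarrow> real^2" where
  "circle_loop \<sigma> c a t = c + rotate_by (\<sigma> * 2 * pi * t) (a - c)"

text \<open>
  The small circles have radius \<open>norm r0 / 2\<close>, so that they meet the segments from
  \<open>0\<close> to \<open>\<plusminus>r0\<close> in the midpoints \<open>\<plusminus>r0/2\<close>. Any radius in \<open>{0<..<norm r0}\<close> gives
  a homotopic loop.
\<close>

definition alpha_loop :: "real^2 \<Rightarrow> real \<Rightarrow> real^2" where
  "alpha_loop r0 =
     linepath 0 (r0 /\<^sub>R 2) +++ circle_loop (- 1) r0 (r0 /\<^sub>R 2) +++ linepath (r0 /\<^sub>R 2) 0"

definition beta_loop :: "real^2 \<Rightarrow> real \<Rightarrow> real^2" where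
  "beta_loop r0 =
     linepath 0 (- r0 /\<^sub>R 2) +++ circle_loop 1 (- r0) (- r0 /\<^sub>R 2) +++ linepath (- r0 /\<^sub>R 2) 0"

fun loop_power :: "(real \<Rightarrow> 'a::topological_space) \<Rightarrow> nat \<Rightarrow> real \<Rightarrow> 'a" where
  "loop_power p 0 = (\<lambda>_. pathstart p)"
| "loop_power p (Suc 0) = p"
| "loop_power p (Suc (Suc k)) = p +++ loop_power p (Suc k)"

text \<open>
  A closed curve \<open>r\<close> on \<open>{0..\<omega>}\<close> is rescaled to the parameter interval \<open>{0..1}\<close>;
  \<open>homotopic_loops\<close> is free homotopy without a fixed base point.
\<close>

definition coils :: "real^2 \<Rightarrow> nat \<Rightarrow> real \<Rightarrow> (real \<Rightarrow> real^2) \<Rightarrow> bool" where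
  "coils r0 m \<omega> r \<longleftrightarrow>
     homotopic_loops (config_space r0) (\<lambda>s. r (\<omega> * s))
       (loop_power (alpha_loop r0) m +++ loop_power (beta_loop r0) m)"

definition eight_like :: "real^2 \<Rightarrow> real \<Rightarrow> (real \<Rightarrow> real^2) \<Rightarrow> bool" where
  "eight_like r0 \<omega> r \<longleftrightarrow>
     homotopic_loops (config_space r0) (\<lambda>s. r (\<omega> * s)) (alpha_loop r0 +++ beta_loop r0)"

end

theory Submission
  imports Defs "HOL-Complex_Analysis.Great_Picard"
begin

text \<open>
  The potential is even and \<open>\<beta>\<close> is the point reflection of the reversed loop \<open>\<alpha>\<close>. So it suffices
  to find a solution on a half period \<open>{0..\<omega>/2}\<close> that starts and ends at \<open>0\<close> and is homotopic to
  \<open>\<alpha>\<^sup>m\<close> with fixed end points: the gradient vanishes at \<open>0\<close>, hence the odd \<open>\<omega>\<close>-periodic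
  extension is again \<open>C\<^sup>2\<close>.

  This solution minimises the action in its homotopy class. Since \<open>n \<ge> 2\<close>, paths of bounded
  action stay away from the singularities (Gordon's strong force condition), so the class is closed
  under the limits provided by the theorem of Arzela and Ascoli. To avoid Sobolev spaces, the
  kinetic energy is replaced by its discretisations at the dyadic points, which increase with the
  level. Varying the minimiser by dyadic hat functions determines its second differences, and
  these agree with those of the double integral of the force.
\<close>

subsection \<open>Dyadic energy\<close>

text \<open>Minimising over free loops would call for an argument that minimising sequences do not
  drift to infinity. With both ends fixed at \<open>0\<close>, a bound on the energy already bounds
  the whole curve. The price is that a minimiser with fixed ends has no prescribed velocity there.
  The odd reflection repairs this: it continues the velocity evenly, hence without a jump, and only
  the acceleration has to vanish at the ends.

  Level \<open>k\<close> of the discretisation is the integral of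
  \<open>\<bar>p'\<bar>\<^sup>2\<close> for the polygon \<open>p\<close> that interpolates
  \<open>q\<close> at the multiples of \<open>1 / 2 ^ k\<close>. It depends on finitely many values
  of \<open>q\<close>, so it is continuous under pointwise convergence, and the supremum over the
  levels is lower semicontinuous. A perturbation that is affine on the intervals of level
  \<open>k\<close> changes all levels from \<open>k\<close> on by the same amount. So the variation
  of the supremum is a finite expression, although the curve is not yet known to be
  differentiable.\<close>

definition dyadic_energy :: "nat \<Rightarrow> (real \<Rightarrow> 'a::real_inner) \<Rightarrow> real" where
  "dyadic_energy k q =
     2 ^ k * (\<Sum>j<2 ^ k. (norm (q (real (Suc j) / 2 ^ k) - q (real j / 2 ^ k)))\<^sup>2)"

lemma sum_lessThan_double:
  fixes f :: "nat \<Rightarrow> 'a::comm_monoid_add"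
  shows "(\<Sum>j<2 * n. f j) = (\<Sum>j<n. f (2 * j) + f (Suc (2 * j)))"
  by (induction n) (auto simp: add.assoc)

text \<open>Parallelogram law for \<open>m - a\<close> and \<open>b - m\<close>: their difference is
  twice the deviation of \<open>m\<close> from the midpoint of \<open>a\<close> and
  \<open>b\<close>.\<close>

lemma norm_split_midpoint:
  fixes a b m :: "'a::real_inner"
  shows "2 * ((norm (m - a))\<^sup>2 + (norm (b - m))\<^sup>2)
    = (norm (b - a))\<^sup>2 + 4 * (norm (m - (a + b) /\<^sub>R 2))\<^sup>2"
  by (simp add: power2_norm_eq_inner algebra_simps inner_commute)

text \<open>Refining the grid adds exactly the squared deviations of the new points from the
  midpoints of the old chords. The gain is nonnegative, and it does not see affine
  perturbations.\<close>

lemma dyadic_energy_Suc: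
  fixes q :: "real \<Rightarrow> 'a::real_inner"
  shows "dyadic_energy (Suc k) q = dyadic_energy k q + 4 * 2 ^ k *
    (\<Sum>j<2 ^ k. (norm (q (real (Suc (2 * j)) / 2 ^ Suc k)
        - (q (real j / 2 ^ k) + q (real (Suc j) / 2 ^ k)) /\<^sub>R 2))\<^sup>2)"
proof -
  have e: "real (2 * j) / 2 ^ Suc k = real j / 2 ^ k"
    "real (Suc (Suc (2 * j))) / 2 ^ Suc k = real (Suc j) / 2 ^ k" for j
    by (simp_all add: field_simps)
  let ?a = "\<lambda>j. q (real j / 2 ^ k)" and ?m = "\<lambda>j. q (real (Suc (2 * j)) / 2 ^ Suc k)"
  have "dyadic_energy (Suc k) q = 2 ^ k * (\<Sum>j<2 ^ k.
      2 * ((norm (?m j - ?a j))\<^sup>2 + (norm (?a (Suc j) - ?m j))\<^sup>2))"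
    unfolding dyadic_energy_def power_Suc[of 2 k] sum_lessThan_double
    unfolding power_Suc[symmetric] e by (simp add: sum_distrib_left algebra_simps)
  also have "\<dots> = 2 ^ k * (\<Sum>j<2 ^ k. (norm (?a (Suc j) - ?a j))\<^sup>2
      + 4 * (norm (?m j - (?a j + ?a (Suc j)) /\<^sub>R 2))\<^sup>2)"
    by (simp only: norm_split_midpoint)
  finally show ?thesis
    by (simp add: dyadic_energy_def sum.distrib algebra_simps sum_distrib_left)
qed

lemma dyadic_energy_mono:
  assumes "k \<le> l"
  shows "dyadic_energy k q \<le> dyadic_energy l q"
  using assms
proof (induction l rule: dec_induct)
  case (step l)
  have "dyadic_energy l q \<le> dyadic_energy (Suc l) q"
    unfolding dyadic_energy_Suc by (simp add: sum_nonneg)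
  with step.IH show ?case by linarith
qed simp

lemma dyadic_energy_nonneg: "0 \<le> dyadic_energy k q"
  by (simp add: dyadic_energy_def sum_nonneg)

text \<open>Perturbing by a function that is affine on the intervals of level \<open>k\<close> leaves the
  midpoint defects in \<open>dyadic_energy_Suc\<close> unchanged.\<close>

lemma dyadic_energy_add_affine:
  fixes q p :: "real \<Rightarrow> 'a::real_inner"
  assumes "k \<le> l"
    and mid: "\<And>l j. k \<le> l \<Longrightarrow> j < 2 ^ l \<Longrightarrow> p (real (Suc (2 * j)) / 2 ^ Suc l)
        = (p (real j / 2 ^ l) + p (real (Suc j) / 2 ^ l)) /\<^sub>R 2"
  shows "dyadic_energy l (\<lambda>t. q t + p t) - dyadic_energy l q
    = dyadic_energy k (\<lambda>t. q t + p t) - dyadic_energy k q"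
  using assms(1)
proof (induction l rule: dec_induct)
  case (step l)
  have "(\<Sum>j<2 ^ l. (norm (q (real (Suc (2 * j)) / 2 ^ Suc l) + p (real (Suc (2 * j)) / 2 ^ Suc l)
        - ((q (real j / 2 ^ l) + p (real j / 2 ^ l))
            + (q (real (Suc j) / 2 ^ l) + p (real (Suc j) / 2 ^ l))) /\<^sub>R 2))\<^sup>2)
    = (\<Sum>j<2 ^ l. (norm (q (real (Suc (2 * j)) / 2 ^ Suc l)
        - (q (real j / 2 ^ l) + q (real (Suc j) / 2 ^ l)) /\<^sub>R 2))\<^sup>2)"
  proof (intro sum.cong refl)
    fix j :: nat assume "j \<in> {..<2 ^ l}"
    then have *: "p (real (Suc (2 * j)) / 2 ^ Suc l)
        = (p (real j / 2 ^ l) + p (real (Suc j) / 2 ^ l)) /\<^sub>R 2"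
      using step.hyps by (intro mid) auto
    show "(norm (q (real (Suc (2 * j)) / 2 ^ Suc l) + p (real (Suc (2 * j)) / 2 ^ Suc l)
        - ((q (real j / 2 ^ l) + p (real j / 2 ^ l))
            + (q (real (Suc j) / 2 ^ l) + p (real (Suc j) / 2 ^ l))) /\<^sub>R 2))\<^sup>2
      = (norm (q (real (Suc (2 * j)) / 2 ^ Suc l)
        - (q (real j / 2 ^ l) + q (real (Suc j) / 2 ^ l)) /\<^sub>R 2))\<^sup>2"
      unfolding * by (simp add: algebra_simps)
  qed
  with step.IH show ?case
    unfolding dyadic_energy_Suc by simp
qed simp

section \<open>Dyadic approximation and Hoelder continuity\<close>

lemma dyadic_approx:
  fixes t :: real
  shows "(\<lambda>k. real (nat \<lfloor>t * 2 ^ k\<rfloor>) / 2 ^ k) \<longlonglongrightarrow> max 0 t"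
proof (rule tendsto_sandwich)
  have lim: "(\<lambda>k. 1 / 2 ^ k :: real) \<longlonglongrightarrow> 0"
    using LIMSEQ_power_zero[of "1/2::real"] by (simp add: power_divide)
  show "(\<lambda>k. max 0 t - 1 / 2 ^ k) \<longlonglongrightarrow> max 0 t"
    using tendsto_diff[OF tendsto_const lim] by simp
  show "(\<lambda>k. max 0 t) \<longlonglongrightarrow> max 0 t" by simp
  show "\<forall>\<^sub>F k in sequentially. max 0 t - 1 / 2 ^ k \<le> real (nat \<lfloor>t * 2 ^ k\<rfloor>) / 2 ^ k"
  proof (intro always_eventually allI)
    fix k
    have "t * 2 ^ k - 1 \<le> real (nat \<lfloor>t * 2 ^ k\<rfloor>)"
      by linarith
    then have "max 0 t * 2 ^ k - 1 \<le> real (nat \<lfloor>t * 2 ^ k\<rfloor>)"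
      by (cases "t \<ge> 0") (simp_all add: max_def)
    then show "max 0 t - 1 / 2 ^ k \<le> real (nat \<lfloor>t * 2 ^ k\<rfloor>) / 2 ^ k"
      by (simp add: le_divide_eq left_diff_distrib)
  qed
  show "\<forall>\<^sub>F k in sequentially. real (nat \<lfloor>t * 2 ^ k\<rfloor>) / 2 ^ k \<le> max 0 t"
  proof (intro always_eventually allI)
    fix k
    \<comment> \<open>Truncation by \<open>nat\<close> sends negative \<open>t\<close> to 0, hence
      the limit \<open>max 0 t\<close>; on the unit interval this is \<open>t\<close>.\<close>
    have "nat \<lfloor>t * 2 ^ k\<rfloor> = 0" if "t \<le> 0"
      using that mult_nonpos_nonneg[of t "2 ^ k"] by (simp add: floor_le_iff)
    then have "real (nat \<lfloor>t * 2 ^ k\<rfloor>) \<le> max 0 t * 2 ^ k"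
      using of_nat_floor[of "t * 2 ^ k"] by (cases "t \<le> 0") (simp_all add: max_def del: of_nat_nat)
    then show "real (nat \<lfloor>t * 2 ^ k\<rfloor>) / 2 ^ k \<le> max 0 t"
      by (simp add: field_simps)
  qed
qed

lemma dyadic_floor_le:
  fixes s t :: real
  assumes "s \<le> t" "t \<le> 1"
  shows "nat \<lfloor>s * 2 ^ k\<rfloor> \<le> nat \<lfloor>t * 2 ^ k\<rfloor>" "nat \<lfloor>t * 2 ^ k\<rfloor> \<le> 2 ^ k"
proof -
  show "nat \<lfloor>s * 2 ^ k\<rfloor> \<le> nat \<lfloor>t * 2 ^ k\<rfloor>"
    using assms by (intro nat_mono floor_mono mult_right_mono) auto
  have "t * 2 ^ k \<le> 2 ^ k"
    using assms mult_right_mono[of t 1 "2 ^ k"] by simp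
  then have "\<lfloor>t * 2 ^ k\<rfloor> \<le> \<lfloor>2 ^ k :: real\<rfloor>"
    by (rule floor_mono)
  then show "nat \<lfloor>t * 2 ^ k\<rfloor> \<le> 2 ^ k"
    by (metis floor_of_int floor_of_nat nat_int nat_mono of_nat_numeral of_nat_power)
qed

lemma continuous_dyadic_approx:
  fixes q :: "real \<Rightarrow> 'a::topological_space"
  assumes "continuous_on {0..1} q" "t \<in> {0..1}"
  shows "(\<lambda>k. q (real (nat \<lfloor>t * 2 ^ k\<rfloor>) / 2 ^ k)) \<longlonglongrightarrow> q t"
proof (rule continuous_on_tendsto_compose[OF assms(1)])
  show "(\<lambda>k. real (nat \<lfloor>t * 2 ^ k\<rfloor>) / 2 ^ k) \<longlonglongrightarrow> t"
    using dyadic_approx[of t] assms(2) by (simp add: max_def)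
  have "real (nat \<lfloor>t * 2 ^ k\<rfloor>) \<le> 2 ^ k" for k
    using dyadic_floor_le(2)[of t t k] assms(2)
    by (metis atLeastAtMost_iff of_nat_le_iff of_nat_numeral of_nat_power order_refl)
  then show "\<forall>\<^sub>F k in sequentially. real (nat \<lfloor>t * 2 ^ k\<rfloor>) / 2 ^ k \<in> {0..1}"
    by (intro always_eventually) auto
qed fact

text \<open>Telescoping and the Cauchy-Schwarz inequality over the \<open>j - i\<close> steps
  between the two grid points.\<close>

lemma dyadic_energy_hoelder_dyadic:
  assumes "i \<le> j" "j \<le> 2 ^ k"
  shows "(norm (q (real j / 2 ^ k) - q (real i / 2 ^ k)))\<^sup>2
    \<le> dyadic_energy k q * (real j / 2 ^ k - real i / 2 ^ k)"
proof -
  let ?d = "\<lambda>l. norm (q (real (Suc l) / 2 ^ k) - q (real l / 2 ^ k))"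
  have "q (real j / 2 ^ k) - q (real i / 2 ^ k)
      = (\<Sum>l = i..<j. q (real (Suc l) / 2 ^ k) - q (real l / 2 ^ k))"
    using assms(1) by (subst sum_Suc_diff') auto
  then have "norm (q (real j / 2 ^ k) - q (real i / 2 ^ k)) \<le> (\<Sum>l = i..<j. ?d l)"
    by (simp only: norm_sum)
  then have "(norm (q (real j / 2 ^ k) - q (real i / 2 ^ k)))\<^sup>2 \<le> (\<Sum>l = i..<j. ?d l)\<^sup>2"
    by (intro power_mono) auto
  also have "\<dots> \<le> (\<Sum>l = i..<j. (?d l)\<^sup>2) * real (j - i)"
    using sum_squared_le_sum_of_squares[of ?d "{i..<j}"] by simp
  also have "\<dots> \<le> (\<Sum>l < 2 ^ k. (?d l)\<^sup>2) * real (j - i)"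
    using assms(2) by (intro mult_right_mono sum_mono2) auto
  also have "\<dots> = dyadic_energy k q * (real j / 2 ^ k - real i / 2 ^ k)"
    using assms(1) by (simp add: dyadic_energy_def field_simps of_nat_diff)
  finally show ?thesis .
qed

text \<open>The discrete form of the embedding of finite energy curves into the Hoelder space of
  exponent 1/2, by density of the dyadic points. It provides the equicontinuity and the bound for
  the theorem of Arzela and Ascoli.\<close>

lemma dyadic_energy_hoelder:
  assumes q: "continuous_on {0..1} q" and C: "\<And>k. dyadic_energy k q \<le> C"
    and st: "s \<in> {0..1}" "t \<in> {0..1}"
  shows "(norm (q t - q s))\<^sup>2 \<le> C * \<bar>t - s\<bar>"
proof -
  have main: "(norm (q t - q s))\<^sup>2 \<le> C * (t - s)" if "s \<le> t" "s \<in> {0..1}" "t \<in> {0..1}" for s t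
  proof (rule LIMSEQ_le)
    let ?f = "\<lambda>t k. real (nat \<lfloor>t * 2 ^ k\<rfloor>) / 2 ^ k"
    show "(\<lambda>k. (norm (q (?f t k) - q (?f s k)))\<^sup>2) \<longlonglongrightarrow> (norm (q t - q s))\<^sup>2"
      using that by (intro tendsto_intros continuous_dyadic_approx[OF q])
    show "(\<lambda>k. C * (?f t k - ?f s k)) \<longlonglongrightarrow> C * (t - s)"
      using that dyadic_approx[of t] dyadic_approx[of s]
      by (intro tendsto_intros) (auto simp: max_def)
    have "(norm (q (?f t k) - q (?f s k)))\<^sup>2 \<le> C * (?f t k - ?f s k)" for k
    proof -
      note le = dyadic_floor_le[of s t k]
      have "(norm (q (?f t k) - q (?f s k)))\<^sup>2 \<le> dyadic_energy k q * (?f t k - ?f s k)"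
        using le that by (intro dyadic_energy_hoelder_dyadic) auto
      also have "\<dots> \<le> C * (?f t k - ?f s k)"
        using divide_right_mono[OF of_nat_mono[OF le(1), where 'a = real], of "2 ^ k"] that
        by (intro mult_right_mono C) (simp del: of_nat_nat)
      finally show ?thesis .
    qed
    then show "\<exists>N. \<forall>k\<ge>N. (norm (q (?f t k) - q (?f s k)))\<^sup>2 \<le> C * (?f t k - ?f s k)"
      by blast
  qed
  show ?thesis
    using main[of s t] main[of t s] st by (cases "s \<le> t") (auto simp: norm_minus_commute)
qed

lemma dyadic_energy_tendsto:
  assumes "\<And>t. t \<in> {0..1} \<Longrightarrow> (\<lambda>i. q i t) \<longlonglongrightarrow> p t"
  shows "(\<lambda>i. dyadic_energy k (q i)) \<longlonglongrightarrow> dyadic_energy k p"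
proof -
  have "real j / 2 ^ k \<in> {0..1}" if "j \<le> 2 ^ k" for j
  proof -
    have "real j \<le> 2 ^ k" using that by (metis of_nat_le_iff of_nat_numeral of_nat_power)
    then show ?thesis by simp
  qed
  then show ?thesis
    unfolding dyadic_energy_def by (intro tendsto_intros assms) (auto simp del: of_nat_Suc)
qed

lemma dyadic_energy_lipschitz:
  assumes "\<And>s t. s \<in> {0..1} \<Longrightarrow> t \<in> {0..1} \<Longrightarrow> norm (q t - q s) \<le> L * \<bar>t - s\<bar>"
  shows "dyadic_energy k q \<le> L\<^sup>2"
proof -
  have *: "(norm (q (real (Suc j) / 2 ^ k) - q (real j / 2 ^ k)))\<^sup>2 \<le> (L / 2 ^ k)\<^sup>2"
    if "j < 2 ^ k" for j
  proof (rule power_mono)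
    have le: "real (Suc j) \<le> 2 ^ k" using that
      by (metis Suc_leI of_nat_le_iff of_nat_numeral of_nat_power)
    then have "norm (q (real (Suc j) / 2 ^ k) - q (real j / 2 ^ k))
        \<le> L * \<bar>real (Suc j) / 2 ^ k - real j / 2 ^ k\<bar>"
      using that le by (intro assms) (auto simp: divide_le_eq)
    then show "norm (q (real (Suc j) / 2 ^ k) - q (real j / 2 ^ k)) \<le> L / 2 ^ k"
      by (simp add: diff_divide_distrib[symmetric])
  qed simp
  have "dyadic_energy k q \<le> 2 ^ k * (\<Sum>j<2 ^ k :: nat. (L / 2 ^ k)\<^sup>2)"
    unfolding dyadic_energy_def using * by (intro mult_left_mono sum_mono) auto
  also have "\<dots> = L\<^sup>2"
    by (simp add: power2_eq_square)
  finally show ?thesis .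
qed

subsection \<open>Strong forces and the collision estimate\<close>

text \<open>
  \<open>W\<close> is minus the potential and \<open>G\<close> its gradient. The lower bound on \<open>W\<close> near the
  complement of \<open>S\<close> is Gordon's strong force condition.
\<close>

locale strong_force =
  fixes S :: "'a::euclidean_space set" and W :: "'a \<Rightarrow> real" and G :: "'a \<Rightarrow> 'a"
    and a b :: real
  assumes open_S: "open S"
    and gradient: "\<And>x. x \<in> S \<Longrightarrow> GDERIV W x :> G x"
    and continuous_G: "continuous_on S G"
    and W_nonneg: "\<And>x. 0 \<le> W x"
    and a_pos: "0 < a"
    and strong: "\<And>x c. x \<in> S \<Longrightarrow> c \<notin> S \<Longrightarrow> a / (norm (x - c))\<^sup>2 \<le> W x + b"
begin

lemma continuous_W: "continuous_on S W"
proof -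
  have "isCont W x" if "x \<in> S" for x
    using gradient[OF that] unfolding gderiv_def by (rule has_derivative_continuous)
  then show ?thesis
    by (simp add: continuous_at_imp_continuous_on)
qed

lemma integrable_W:
  assumes "path q" "path_image q \<subseteq> S"
  shows "(\<lambda>t. W (q t)) integrable_on {0..1}"
  using assms unfolding path_def path_image_def
  by (intro integrable_continuous_real continuous_on_compose2[OF continuous_W]) auto

text \<open>The logarithm of the distance to a singularity varies by at most
  \<open>\<integral> \<bar>q'\<bar> / \<rho> \<le> (\<integral> \<bar>q'\<bar>\<^sup>2 + \<integral> 1 / \<rho>\<^sup>2) / 2\<close>, up to the factor \<open>2\<close> lost by discretising.\<close>

lemma collision_estimate:
  assumes q: "path q" "path_image q \<subseteq> S"
    and E: "\<And>k. dyadic_energy k q \<le> A" and I: "integral {0..1} (\<lambda>t. W (q t)) \<le> B"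
    and c: "c \<notin> S" and t: "t \<in> {0..1}"
  shows "norm (q 0 - c) * exp (- (A + 2 * (B + \<bar>b\<bar>) / a)) \<le> norm (q t - c)"
proof -
  define \<rho> where "\<rho> t = norm (q t - c)" for t
  have cq: "continuous_on {0..1} q" and qS: "\<And>t. t \<in> {0..1} \<Longrightarrow> q t \<in> S"
    using q by (auto simp: path_def path_image_def)
  have c\<rho>: "continuous_on {0..1} \<rho>"
    unfolding \<rho>_def by (intro continuous_intros cq)
  have \<rho>pos: "0 < \<rho> t" if "t \<in> {0..1}" for t
    using qS[OF that] c by (auto simp: \<rho>_def)
  let ?w = "\<lambda>t. 1 / (\<rho> t)\<^sup>2"
  have cw: "continuous_on {0..1} ?w"
    using \<rho>pos by (intro continuous_intros c\<rho>) (auto simp: less_imp_neq[symmetric])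
  have iw: "?w integrable_on {0..1}"
    by (intro integrable_continuous_real cw)
  have "integral {0..1} ?w \<le> integral {0..1} (\<lambda>t. (W (q t) + \<bar>b\<bar>) / a)"
  proof (rule integral_le[OF iw])
    show "(\<lambda>t. (W (q t) + \<bar>b\<bar>) / a) integrable_on {0..1}"
      using integrable_W[OF q] by (intro integrable_on_divide integrable_add) auto
    fix t :: real assume "t \<in> {0..1}"
    then show "?w t \<le> (W (q t) + \<bar>b\<bar>) / a"
      using strong[OF qS c, of t] a_pos by (simp add: \<rho>_def field_simps)
  qed
  also have "\<dots> = (integral {0..1} (\<lambda>t. W (q t)) + \<bar>b\<bar>) / a"
    by (simp add: Henstock_Kurzweil_Integration.integral_add[OF integrable_W[OF q] integrable_const_ivl])
  also have "\<dots> \<le> (B + \<bar>b\<bar>) / a"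
    using I a_pos by (simp add: divide_right_mono)
  finally have Iw: "integral {0..1} ?w \<le> (B + \<bar>b\<bar>) / a" .

  obtain d where "d > 0" and d: "\<And>s t. s \<in> {0..1} \<Longrightarrow> t \<in> {0..1} \<Longrightarrow> \<bar>s - t\<bar> < d \<Longrightarrow> ?w t \<le> 2 * ?w s"
  proof -
    have pos: "0 < ?w t" if "t \<in> {0..1}" for t using \<rho>pos[OF that] by simp
    obtain x where x: "x \<in> {0..1::real}" "\<And>y. y \<in> {0..1} \<Longrightarrow> ?w x \<le> ?w y"
      using continuous_attains_inf[OF _ _ cw] by auto
    \<comment> \<open>The minimum of \<open>?w\<close> serves as the epsilon of uniform continuity,
      so that an additive error becomes a factor of at most 2.\<close>
    have "uniformly_continuous_on {0..1} ?w"
      by (intro compact_uniformly_continuous cw) auto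
    then obtain d where "d > 0" "\<And>s t. s \<in> {0..1} \<Longrightarrow> t \<in> {0..1} \<Longrightarrow> dist t s < d \<Longrightarrow> dist (?w t) (?w s) < ?w x"
      unfolding uniformly_continuous_on_def using pos[OF x(1)] by metis
    note dd = this
    show ?thesis
    proof (rule that[OF dd(1)])
      fix s t :: real assume st: "s \<in> {0..1}" "t \<in> {0..1}" "\<bar>s - t\<bar> < d"
      have "\<bar>?w t - ?w s\<bar> < ?w x"
        using dd(2)[OF st(1,2)] st(3) by (simp add: dist_real_def abs_minus_commute)
      with x(2)[OF st(1)] show "?w t \<le> 2 * ?w s" by linarith
    qed
  qed
  have dyadic: "ln (\<rho> 0) - ln (\<rho> (real i / 2 ^ k)) \<le> A + 2 * (B + \<bar>b\<bar>) / a"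
    if k: "1 / 2 ^ k < d" and i: "i \<le> 2 ^ k" for i k
  proof -
    let ?t = "\<lambda>j. real j / 2 ^ k"
    let ?e = "\<lambda>j. 2 ^ k * (norm (q (?t (Suc j)) - q (?t j)))\<^sup>2"
    have t01: "?t j \<in> {0..1}" if "j \<le> 2 ^ k" for j
    proof -
      have "real j \<le> 2 ^ k" using that by (metis of_nat_le_iff of_nat_numeral of_nat_power)
      then show ?thesis by simp
    qed
    have step: "ln (\<rho> (?t j)) - ln (\<rho> (?t (Suc j))) \<le> ?e j + 2 * integral {?t j..?t (Suc j)} ?w"
      if j: "j < 2 ^ k" for j
    proof -
      let ?s = "?t j" and ?u = "?t (Suc j)"
      have su: "?s \<in> {0..1}" "?u \<in> {0..1}" using t01[of j] t01[of "Suc j"] j by auto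
      have len: "?u - ?s = 1 / 2 ^ k" by (simp add: diff_divide_distrib[symmetric])
      have "?s \<le> ?u" by (intro divide_right_mono) auto
      have "ln (\<rho> ?s) - ln (\<rho> ?u) \<le> (\<rho> ?s - \<rho> ?u) / \<rho> ?u"
        using su by (intro ln_diff_le \<rho>pos)
      also have "\<dots> \<le> norm (q ?u - q ?s) / \<rho> ?u"
        using su \<rho>pos[OF su(2)] norm_triangle_ineq3[of "q ?s - c" "q ?u - c"]
        by (intro divide_right_mono) (auto simp: \<rho>_def norm_minus_commute)
      also have "\<dots> \<le> ?e j + ?w ?u / 2 ^ k"
      proof -
        \<comment> \<open>With \<open>X\<close> the slope of the chord and
          \<open>Y = 1 / \<rho> ?u\<close>, the sum of squares is
          \<open>2 * (X\<^sup>2 + Y\<^sup>2 - X * Y)\<close>; this gives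
          \<open>X * Y \<le> X\<^sup>2 + Y\<^sup>2\<close>, divided by \<open>2 ^ k\<close>.\<close>
        have "0 \<le> (2 ^ k * norm (q ?u - q ?s) - 1 / \<rho> ?u)\<^sup>2
            + (2 ^ k * norm (q ?u - q ?s))\<^sup>2 + (1 / \<rho> ?u)\<^sup>2"
          by simp
        also have "\<dots> = 2 * 2 ^ k * (?e j + ?w ?u / 2 ^ k - norm (q ?u - q ?s) / \<rho> ?u)"
          by (simp add: power2_eq_square algebra_simps)
        finally show ?thesis by (simp add: zero_le_mult_iff power_le_zero_eq del: of_nat_Suc)
      qed
      also have "?w ?u / 2 ^ k \<le> 2 * integral {?s..?u} ?w"
      proof -
        have "integral {?s..?u} (\<lambda>_. ?w ?u) \<le> integral {?s..?u} (\<lambda>s. 2 * ?w s)"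
        proof (rule integral_le)
          have "continuous_on {?s..?u} ?w"
            using su by (intro continuous_on_subset[OF cw]) auto
          then show "(\<lambda>s. 2 * ?w s) integrable_on {?s..?u}"
            by (intro integrable_continuous_real continuous_on_mult_left)
          fix s assume s: "s \<in> {?s..?u}"
          have "s \<in> {0..1}" "\<bar>s - ?u\<bar> < d"
            using s su len k unfolding atLeastAtMost_iff by linarith+
          then show "?w ?u \<le> 2 * ?w s"
            using su by (intro d)
        qed auto
        moreover have "integral {?s..?u} (\<lambda>_. ?w ?u) = ?w ?u / 2 ^ k"
          using \<open>?s \<le> ?u\<close> len by (simp del: of_nat_Suc)
        ultimately show ?thesis
          by (simp only: Henstock_Kurzweil_Integration.integral_mult_right)
      qed
      finally show ?thesis by simp
    qed
    have "ln (\<rho> 0) - ln (\<rho> (?t i)) = (\<Sum>j<i. ln (\<rho> (?t j)) - ln (\<rho> (?t (Suc j))))"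
      by (subst sum_lessThan_telescope') simp
    also have "\<dots> \<le> (\<Sum>j<i. ?e j + 2 * integral {?t j..?t (Suc j)} ?w)"
      using i by (intro sum_mono step) auto
    also have "\<dots> = (\<Sum>j<i. ?e j) + 2 * integral {0..?t i} ?w"
    proof -
      have "(\<Sum>j<i. integral {?t j..?t (Suc j)} ?w) = integral {0..?t i} ?w"
        using i
      proof (induction i)
        case (Suc i)
        have "?w integrable_on {0..?t (Suc i)}"
          using t01[OF Suc.prems] by (intro integrable_on_subinterval[OF iw]) auto
        moreover have "?t i \<le> ?t (Suc i)" by (intro divide_right_mono) auto
        ultimately show ?case
          using Suc Henstock_Kurzweil_Integration.integral_combine[of 0 "?t i" "?t (Suc i)" ?w] by (simp del: of_nat_Suc)
      qed simp
      then show ?thesis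
        by (simp add: sum.distrib sum_distrib_left[symmetric] del: of_nat_Suc)
    qed
    also have "(\<Sum>j<i. ?e j) \<le> (\<Sum>j<2 ^ k. ?e j)"
      using i by (intro sum_mono2) auto
    also have "\<dots> = dyadic_energy k q"
      by (simp add: dyadic_energy_def sum_distrib_left)
    also have "\<dots> \<le> A" by (rule E)
    also have "integral {0..?t i} ?w \<le> integral {0..1} ?w"
      using t01[OF i] by (intro integral_subset_le integrable_on_subinterval[OF iw] iw) auto
    finally have "ln (\<rho> 0) - ln (\<rho> (?t i)) \<le> A + 2 * integral {0..1} ?w" by simp
    also have "\<dots> \<le> A + 2 * ((B + \<bar>b\<bar>) / a)"
      by (intro add_left_mono mult_left_mono Iw) auto
    finally show ?thesis by simp
  qed
  have "ln (\<rho> 0) - ln (\<rho> t) \<le> A + 2 * (B + \<bar>b\<bar>) / a"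
  proof (rule LIMSEQ_le_const2)
    show "(\<lambda>k. ln (\<rho> 0) - ln (\<rho> (real (nat \<lfloor>t * 2 ^ k\<rfloor>) / 2 ^ k))) \<longlonglongrightarrow> ln (\<rho> 0) - ln (\<rho> t)"
      using \<rho>pos[OF t] by (intro tendsto_intros continuous_dyadic_approx[OF c\<rho> t]) auto
    have "(\<lambda>k. 1 / 2 ^ k :: real) \<longlonglongrightarrow> 0"
      using LIMSEQ_power_zero[of "1/2::real"] by (simp add: power_divide)
    then have "\<forall>\<^sub>F k in sequentially. 1 / 2 ^ k < d"
      using \<open>d > 0\<close> by (rule order_tendstoD)
    then show "\<exists>N. \<forall>k\<ge>N. ln (\<rho> 0) - ln (\<rho> (real (nat \<lfloor>t * 2 ^ k\<rfloor>) / 2 ^ k))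
        \<le> A + 2 * (B + \<bar>b\<bar>) / a"
      unfolding eventually_sequentially
      using dyadic dyadic_floor_le(2)[of t t] t by (metis atLeastAtMost_iff order_refl)
  qed
  then have "ln (\<rho> 0 * exp (- (A + 2 * (B + \<bar>b\<bar>) / a))) \<le> ln (\<rho> t)"
    using \<rho>pos[of 0] by (simp add: ln_mult)
  then show ?thesis
    using \<rho>pos[of 0] \<rho>pos[OF t] by (simp add: \<rho>_def)
qed

end

subsection \<open>Minimisers in a homotopy class\<close>

lemma polynomial_function_dyadic_energy_bound:
  fixes p :: "real \<Rightarrow> 'a::euclidean_space"
  assumes "polynomial_function p"
  obtains C where "\<And>k. dyadic_energy k p \<le> C"
proof -
  obtain p' where p': "polynomial_function p'" "\<And>x. (p has_vector_derivative p' x) (at x)"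
    using has_vector_derivative_polynomial_function[OF assms] by metis
  have "compact (p' ` {0..1})"
    by (intro compact_continuous_image continuous_on_polymonial_function p') auto
  then obtain L where L: "\<And>x. x \<in> {0..1} \<Longrightarrow> norm (p' x) \<le> L"
    using compact_imp_bounded[of "p' ` {0..1}"] unfolding bounded_iff by blast
  have "norm (p t - p s) \<le> L * \<bar>t - s\<bar>" if "s \<in> {0..1}" "t \<in> {0..1}" for s t
  proof -
    have "norm (p t - p s) \<le> L * norm (t - s)"
    proof (rule differentiable_bound)
      show "(p has_derivative (\<lambda>h. h *\<^sub>R p' x)) (at x within {0..1})" for x
        using p'(2)[of x] has_derivative_at_withinI unfolding has_vector_derivative_def by blast
      show "onorm (\<lambda>h. h *\<^sub>R p' x) \<le> L" if "x \<in> {0..1}" for x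
        using L[OF that] by (intro onorm_le) (simp add: mult.commute[of L] mult_left_mono)
    qed (use that in auto)
    then show ?thesis by simp
  qed
  then show ?thesis
    using that dyadic_energy_lipschitz by metis
qed

text \<open>A merely continuous path may have infinite energy. A polynomial path in its class is
  Lipschitz on the unit interval, so the class contains a competitor of finite action.\<close>

lemma polynomial_path_homotopic:
  fixes g :: "real \<Rightarrow> 'a::euclidean_space"
  assumes "path g" "path_image g \<subseteq> S" "open S"
  obtains p where "polynomial_function p" "homotopic_paths S g p"
proof -
  obtain e where "e > 0" and e: "\<And>h. path h \<Longrightarrow> pathstart h = pathstart g \<Longrightarrow>
      pathfinish h = pathfinish g \<Longrightarrow> (\<forall>t\<in>{0..1}. norm (h t - g t) < e) \<Longrightarrow> homotopic_paths S g h"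
    using homotopic_nearby_paths[OF assms(1,3,2)] by blast
  obtain p where p: "polynomial_function p" "pathstart p = pathstart g" "pathfinish p = pathfinish g"
    "\<And>t. t \<in> {0..1} \<Longrightarrow> norm (p t - g t) < e"
    using path_approx_polynomial_function[OF assms(1) \<open>e > 0\<close>] by blast
  have "path p"
    using p(1) by (simp add: path_def continuous_on_polymonial_function)
  with p e that show ?thesis by blast
qed

context strong_force
begin

text \<open>The action proper is the supremum of \<open>action \<kappa> k q\<close> over \<open>k\<close>.\<close>

definition action :: "real \<Rightarrow> nat \<Rightarrow> (real \<Rightarrow> 'a) \<Rightarrow> real" where
  "action \<kappa> k q = \<kappa> * dyadic_energy k q + integral {0..1} (\<lambda>t. W (q t))"

text \<open>Taking \<open>p = q\<close> shows that \<open>m\<close> is the supremum of the action of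
  \<open>q\<close>, which therefore never has to be written down. Competitors are tested on levels
  \<open>l \<ge> k\<close> only, since the effect of a variation by hats of level \<open>k\<close>
  is known just there.\<close>

definition minimizer :: "real \<Rightarrow> (real \<Rightarrow> 'a) \<Rightarrow> (real \<Rightarrow> 'a) \<Rightarrow> bool" where
  "minimizer \<kappa> g q \<longleftrightarrow> homotopic_paths S g q \<and>
     (\<exists>m. (\<forall>k. action \<kappa> k q \<le> m) \<and>
       (\<forall>p C k. homotopic_paths S g p \<longrightarrow> (\<forall>l\<ge>k. action \<kappa> l p \<le> C) \<longrightarrow> m \<le> C))"

lemma action_mono:
  assumes "0 < \<kappa>" "k \<le> l"
  shows "action \<kappa> k q \<le> action \<kappa> l q"
  using dyadic_energy_mono[OF assms(2), of q] assms(1) by (simp add: action_def)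

lemma action_bounds:
  assumes "0 < \<kappa>" "path q" "path_image q \<subseteq> S" "action \<kappa> k q \<le> C"
  shows "dyadic_energy k q \<le> C / \<kappa>" "integral {0..1} (\<lambda>t. W (q t)) \<le> C" "0 \<le> C"
proof -
  have I: "0 \<le> integral {0..1} (\<lambda>t. W (q t))"
    by (intro Henstock_Kurzweil_Integration.integral_nonneg integrable_W assms W_nonneg)
  have E: "0 \<le> \<kappa> * dyadic_energy k q"
    using assms(1) dyadic_energy_nonneg[of k q] by simp
  show "dyadic_energy k q \<le> C / \<kappa>" "integral {0..1} (\<lambda>t. W (q t)) \<le> C" "0 \<le> C"
    using I E assms(1,4) by (auto simp: action_def field_simps)
qed

text \<open>Such a set traps the curves of a minimising sequence. Being closed it contains their
  limits, and \<open>W\<close> is bounded on it.\<close>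

lemma compact_away_from_singularities:
  assumes "0 < \<delta>"
  shows "compact {x. norm x \<le> M \<and> (\<forall>c. c \<notin> S \<longrightarrow> \<delta> \<le> norm (x - c))}"
    and "{x. norm x \<le> M \<and> (\<forall>c. c \<notin> S \<longrightarrow> \<delta> \<le> norm (x - c))} \<subseteq> S"
proof -
  let ?K = "{x. norm x \<le> M \<and> (\<forall>c. c \<notin> S \<longrightarrow> \<delta> \<le> norm (x - c))}"
  have "?K = cball 0 M \<inter> (\<Inter>c\<in>-S. {x. \<delta> \<le> norm (x - c)})"
    by (auto simp: dist_norm)
  moreover have "closed (\<Inter>c\<in>-S. {x. \<delta> \<le> norm (x - c)})"
    by (intro closed_INT ballI closed_Collect_le continuous_intros)
  ultimately show "compact ?K"
    by (simp add: compact_Int_closed)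
  show "?K \<subseteq> S"
    using assms by force
qed

lemma exists_minimizer:
  assumes g: "path g" "path_image g \<subseteq> S" and \<kappa>: "0 < \<kappa>"
  obtains q where "minimizer \<kappa> g q"
proof -
  \<comment> \<open>Real upper bounds stand in for the values of the action, whose supremum over the
    levels may be infinite.\<close>
  define V where "V = {C. \<exists>q. homotopic_paths S g q \<and> (\<forall>k. action \<kappa> k q \<le> C)}"
  have VD: "0 \<le> C" if "C \<in> V" for C
    using that action_bounds(3)[OF \<kappa>] homotopic_paths_imp_path homotopic_paths_imp_subset
    unfolding V_def by blast
  have bdd: "bdd_below V"
    using VD by (rule bdd_belowI)
  obtain p0 where p0: "polynomial_function p0" "homotopic_paths S g p0"
    using polynomial_path_homotopic[OF g open_S] by blast
  obtain C0 where C0: "\<And>k. dyadic_energy k p0 \<le> C0"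
    using polynomial_function_dyadic_energy_bound[OF p0(1)] by blast
  have "\<kappa> * C0 + integral {0..1} (\<lambda>t. W (p0 t)) \<in> V"
    using p0(2) C0 \<kappa> by (auto simp: V_def action_def intro!: exI[of _ p0])
  then have ne: "V \<noteq> {}" by blast
  define m where "m = Inf V"
  have "\<exists>q. homotopic_paths S g q \<and> (\<forall>k. action \<kappa> k q \<le> m + 1 / Suc i)" for i
  proof -
    have "Inf V < m + 1 / Suc i" by (simp add: m_def)
    then obtain C q where "C < m + 1 / Suc i" "homotopic_paths S g q" "\<And>k. action \<kappa> k q \<le> C"
      using cInf_lessD[OF ne] unfolding V_def by blast
    then show ?thesis by (meson less_imp_le order.trans)
  qed
  then obtain Q where Q: "\<And>i. homotopic_paths S g (Q i)"
    and QA: "\<And>i k. action \<kappa> k (Q i) \<le> m + 1 / Suc i"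
    by metis
  have QA1: "action \<kappa> k (Q i) \<le> m + 1" for i k
  proof -
    have "1 / real (Suc i) \<le> 1" by (simp add: divide_le_eq)
    with QA[of k i] show ?thesis by linarith
  qed
  have pathQ: "path (Q i)" and QS: "path_image (Q i) \<subseteq> S" for i
    using Q homotopic_paths_imp_path homotopic_paths_imp_subset by blast+
  have cQ: "continuous_on {0..1} (Q i)" for i
    using pathQ by (simp add: path_def)
  have Q0: "Q i 0 = g 0" and Q1: "Q i 1 = g 1" for i
    using homotopic_paths_imp_pathstart[OF Q[of i]] homotopic_paths_imp_pathfinish[OF Q[of i]]
    by (auto simp: pathstart_def pathfinish_def)
  define A where "A = (m + 1) / \<kappa>"
  note Qb = action_bounds[OF \<kappa> pathQ QS QA1]
  have A: "dyadic_energy k (Q i) \<le> A" for i k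
    using Qb(1) by (simp add: A_def)
  have A0: "0 \<le> A" using Qb(3) \<kappa> by (simp add: A_def)
  have hoelder: "norm (Q i t - Q i s) \<le> sqrt (A * \<bar>t - s\<bar>)"
    if "s \<in> {0..1}" "t \<in> {0..1}" for i s t
    using dyadic_energy_hoelder[OF cQ A that] by (intro real_le_rsqrt)
  \<comment> \<open>The Hoelder estimate from the common starting point \<open>g 0\<close> moves a
    curve by at most \<open>sqrt A\<close> in unit time.\<close>
  define M where "M = norm (g 0) + sqrt A"
  have QM: "norm (Q i t) \<le> M" if "t \<in> {0..1}" for i t
  proof -
    have "norm (Q i t - g 0) \<le> sqrt (A * \<bar>t\<bar>)"
      using hoelder[of 0 t i] that Q0 by simp
    also have "\<dots> \<le> sqrt A"
      using that A0 mult_left_mono[of t 1 A] by simp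
    finally show ?thesis
      unfolding M_def using norm_triangle_ineq2[of "Q i t" "g 0"] by linarith
  qed
  obtain d0 where "d0 > 0" and d0: "ball (g 0) d0 \<subseteq> S"
    using open_S g(2) unfolding open_contains_ball path_image_def by force
  have d0': "d0 \<le> norm (g 0 - c)" if "c \<notin> S" for c
    using d0 that by (force simp: dist_norm)
  \<comment> \<open>The collision estimate, started at \<open>g 0\<close>, whose distance to every
    singularity is at least \<open>d0\<close>; the bound is the same for all
    \<open>Q i\<close>.\<close>
  define \<delta> where "\<delta> = d0 * exp (- (A + 2 * (m + 1 + \<bar>b\<bar>) / a))"
  have "\<delta> > 0" using \<open>d0 > 0\<close> by (simp add: \<delta>_def)
  have Q\<delta>: "\<delta> \<le> norm (Q i t - c)" if "c \<notin> S" "t \<in> {0..1}" for i t c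
  proof -
    have "\<delta> \<le> norm (Q i 0 - c) * exp (- (A + 2 * (m + 1 + \<bar>b\<bar>) / a))"
      unfolding \<delta>_def Q0 using d0'[OF that(1)] by (intro mult_right_mono) auto
    also have "\<dots> \<le> norm (Q i t - c)"
      by (intro collision_estimate pathQ QS A Qb(2) that)
    finally show ?thesis .
  qed
  obtain q r where cq: "continuous_on {0..1} q" and r: "strict_mono (r :: nat \<Rightarrow> nat)"
    and unif: "\<And>e. 0 < e \<Longrightarrow> \<exists>N. \<forall>n x. n \<ge> N \<and> x \<in> {0..1} \<longrightarrow> norm (Q (r n) x - q x) < e"
  proof (rule Arzela_Ascoli[of "{0..1::real}" Q M])
    show "\<exists>d>0. \<forall>n y. y \<in> {0..1} \<and> norm (x - y) < d \<longrightarrow> norm (Q n x - Q n y) < e"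
      if x: "x \<in> {0..1}" and "0 < e" for x e
    proof (intro exI conjI allI impI)
      \<comment> \<open>The summand 1 covers the case \<open>A = 0\<close>.\<close>
      show "0 < e\<^sup>2 / (A + 1)" using A0 \<open>0 < e\<close> by simp
      fix n y assume y: "y \<in> {0..1} \<and> norm (x - y) < e\<^sup>2 / (A + 1)"
      have "A * \<bar>x - y\<bar> \<le> (A + 1) * \<bar>x - y\<bar>" by (intro mult_right_mono) auto
      also have "\<dots> < e\<^sup>2" using y A0 by (simp add: field_simps)
      finally have "sqrt (A * \<bar>x - y\<bar>) < e"
        using \<open>0 < e\<close> by (simp add: real_less_lsqrt)
      then show "norm (Q n x - Q n y) < e"
        using hoelder[of y x n] x y by linarith
    qed
  qed (use QM in auto)
  have lim: "(\<lambda>n. Q (r n) t) \<longlonglongrightarrow> q t" if "t \<in> {0..1}" for t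
    using unif that unfolding LIMSEQ_iff by blast
  have "path q" using cq by (simp add: path_def)
  define K where "K = {x. norm x \<le> M \<and> (\<forall>c. c \<notin> S \<longrightarrow> \<delta> \<le> norm (x - c))}"
  have K: "compact K" "K \<subseteq> S"
    unfolding K_def by (intro compact_away_from_singularities \<open>\<delta> > 0\<close>)+
  have QK: "Q i t \<in> K" if "t \<in> {0..1}" for i t
    using QM[OF that] Q\<delta>[OF _ that] by (auto simp: K_def)
  have qK: "q t \<in> K" if "t \<in> {0..1}" for t
    by (rule Lim_in_closed_set[OF compact_imp_closed[OF K(1)] _ _ lim[OF that]])
      (use QK that in auto)
  have qS: "path_image q \<subseteq> S"
    using qK K(2) by (auto simp: path_image_def)
  \<comment> \<open>The limit lies in the open set \<open>S\<close>, so paths uniformly close to it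
    with the same ends are homotopic to it in \<open>S\<close>; some \<open>Q (r n)\<close> is such
    a path.\<close>
  have hom: "homotopic_paths S g q"
  proof -
    obtain e where "e > 0" and e: "\<And>h. path h \<Longrightarrow> pathstart h = pathstart q \<Longrightarrow>
        pathfinish h = pathfinish q \<Longrightarrow> (\<forall>t\<in>{0..1}. norm (h t - q t) < e) \<Longrightarrow> homotopic_paths S q h"
      using homotopic_nearby_paths[OF \<open>path q\<close> open_S qS] by blast
    obtain n where n: "\<And>x. x \<in> {0..1} \<Longrightarrow> norm (Q (r n) x - q x) < e"
      using unif[OF \<open>e > 0\<close>] by blast
    have "q 0 = g 0" "q 1 = g 1"
      using lim[of 0] lim[of 1] by (simp_all add: Q0 Q1 LIMSEQ_const_iff)
    then have "homotopic_paths S q (Q (r n))"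
      by (intro e pathQ ballI n) (auto simp: pathstart_def pathfinish_def Q0 Q1)
    then show ?thesis
      using Q homotopic_paths_sym homotopic_paths_trans by blast
  qed
  have "(\<lambda>n. integral {0..1} (\<lambda>t. W (Q (r n) t))) \<longlonglongrightarrow> integral {0..1} (\<lambda>t. W (q t))"
  proof -
    have "compact (W ` K)"
      using K continuous_on_subset[OF continuous_W] by (intro compact_continuous_image) auto
    then obtain B where "\<And>x. x \<in> K \<Longrightarrow> norm (W x) \<le> B"
      using compact_imp_bounded[of "W ` K"] unfolding bounded_iff by auto
    then show ?thesis
      using QK qK K(2) continuous_W pathQ QS
      by (intro dominated_convergence(2)[where h = "\<lambda>_. B"] integrable_W
          continuous_on_tendsto_compose[OF continuous_W lim]) (auto intro!: always_eventually)
  qed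
  then have limA: "(\<lambda>n. action \<kappa> k (Q (r n))) \<longlonglongrightarrow> action \<kappa> k q" for k
    unfolding action_def by (intro tendsto_intros dyadic_energy_tendsto lim)
  \<comment> \<open>The limit is taken at a fixed level, where the action converges; all levels
    share the bound \<open>m\<close>.\<close>
  have "action \<kappa> k q \<le> m" for k
  proof (rule LIMSEQ_le[OF limA])
    show "(\<lambda>n. m + 1 / real (Suc (r n))) \<longlonglongrightarrow> m"
      using tendsto_add[OF tendsto_const LIMSEQ_subseq_LIMSEQ[OF LIMSEQ_Suc[OF lim_1_over_n] r]]
      by (simp add: o_def)
  qed (use QA in blast)
  moreover have "m \<le> C" if p: "homotopic_paths S g p" and C: "\<forall>l\<ge>k. action \<kappa> l p \<le> C" for p C k
  proof -
    \<comment> \<open>By monotonicity in the level, a bound on the high levels is a bound on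
      all.\<close>
    have "action \<kappa> l p \<le> C" for l
      using action_mono[OF \<kappa>, of l "max k l" p] C by (meson max.cobounded1 max.cobounded2 order.trans)
    then have "C \<in> V" using p by (auto simp: V_def)
    then show ?thesis unfolding m_def using bdd by (rule cInf_lower)
  qed
  ultimately have "minimizer \<kappa> g q"
    unfolding minimizer_def using hom by blast
  then show ?thesis by (rule that)
qed

end

subsection \<open>The Euler--Lagrange equation\<close>

definition hat :: "nat \<Rightarrow> nat \<Rightarrow> real \<Rightarrow> real" where
  "hat k i t = max 0 (1 - \<bar>2 ^ k * t - real i\<bar>)"

lemma hat_bounds: "0 \<le> hat k i t" "hat k i t \<le> 1"
  by (auto simp: hat_def)

lemma continuous_hat: "continuous_on A (hat k i)"
  unfolding hat_def by (intro continuous_intros)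

lemma hat_dyadic: "hat k i (real j / 2 ^ k) = (if i = j then 1 else 0)"
proof -
  have "2 ^ k * (real j / 2 ^ k) = real j" by simp
  moreover have "1 \<le> \<bar>real j - real i\<bar>" if "i \<noteq> j"
    using that by linarith
  ultimately show ?thesis unfolding hat_def by auto
qed

lemma hat_boundary:
  assumes "0 < i" "i < 2 ^ k"
  shows "hat k i 0 = 0" "hat k i 1 = 0"
  using hat_dyadic[of k i 0] hat_dyadic[of k i "2 ^ k"] assms by auto

text \<open>An interval of level \<open>l \<ge> k\<close> lies inside one of level \<open>k\<close>,
  and the kinks of the hat are grid points of level \<open>k\<close>, so the hat is affine on
  it.\<close>

lemma hat_midpoint:
  assumes "k \<le> l"
  shows "hat k i (real (Suc (2 * j)) / 2 ^ Suc l)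
    = (hat k i (real j / 2 ^ l) + hat k i (real (Suc j) / 2 ^ l)) / 2"
proof -
  define N :: nat where "N = 2 ^ (l - k)"
  have N: "0 < N" "2 ^ l = 2 ^ k * real N"
    using assms by (simp_all add: N_def power_add[symmetric])
  \<comment> \<open>Index of the level \<open>k\<close> interval that contains the given one;
    multiplied by \<open>2 ^ k\<close> it becomes \<open>[p, p + 1]\<close>.\<close>
  define p where "p = j div N"
  have p: "p * N \<le> j" "Suc j \<le> Suc p * N"
    using N(1) by (simp_all add: p_def Suc_le_eq dividend_less_div_times)
  define s u where "s = real j / N" and "u = real (Suc j) / N"
  have eq: "2 ^ k * (real j / 2 ^ l) = s" "2 ^ k * (real (Suc j) / 2 ^ l) = u"
    "2 ^ k * (real (Suc (2 * j)) / 2 ^ Suc l) = (s + u) / 2"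
    using N by (simp_all add: s_def u_def field_simps)
  have "real p * real N \<le> real j" "real (Suc j) \<le> real (Suc p) * real N"
    using p unfolding of_nat_mult[symmetric] of_nat_le_iff by auto
  then have su: "real p \<le> s" "s \<le> u" "u \<le> real p + 1"
    using N(1) by (simp_all add: s_def u_def field_simps)
  then have mid: "real p \<le> (s + u) / 2" "(s + u) / 2 \<le> real p + 1"
    by simp_all
  \<comment> \<open>On \<open>[p, p + 1]\<close> the hat rises if \<open>p + 1 = i\<close>, falls if
    \<open>p = i\<close>, and vanishes otherwise.\<close>
  consider "p + 1 < i" | "p + 1 = i" | "p = i" | "i < p" by linarith
  then have "max 0 (1 - \<bar>(s + u) / 2 - real i\<bar>)
      = (max 0 (1 - \<bar>s - real i\<bar>) + max 0 (1 - \<bar>u - real i\<bar>)) / 2"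
  proof cases
    case 1
    then have "real p + 2 \<le> real i" by linarith
    with su mid have "1 \<le> \<bar>s - real i\<bar>" "1 \<le> \<bar>u - real i\<bar>" "1 \<le> \<bar>(s + u) / 2 - real i\<bar>"
      by linarith+
    then show ?thesis by (simp add: max_absorb1)
  next
    case 2
    with su show ?thesis by (auto simp: max_def abs_if field_simps)
  next
    case 3
    with su show ?thesis by (auto simp: max_def abs_if field_simps)
  next
    case 4
    then have "real i + 1 \<le> real p" by linarith
    with su mid have "1 \<le> \<bar>s - real i\<bar>" "1 \<le> \<bar>u - real i\<bar>" "1 \<le> \<bar>(s + u) / 2 - real i\<bar>"
      by linarith+
    then show ?thesis by (simp add: max_absorb1)
  qed
  then show ?thesis unfolding hat_def eq .
qed

text \<open>An exact quadratic polynomial in \<open>x\<close>, so its derivative at 0 can be read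
  off from the middle term.\<close>

lemma dyadic_energy_perturb:
  "dyadic_energy k (\<lambda>t. q t + (x * h t) *\<^sub>R v) = dyadic_energy k q
    + 2 * x * 2 ^ k * (\<Sum>j<2 ^ k. (h (real (Suc j) / 2 ^ k) - h (real j / 2 ^ k))
        * ((q (real (Suc j) / 2 ^ k) - q (real j / 2 ^ k)) \<bullet> v))
    + x\<^sup>2 * dyadic_energy k (\<lambda>t. h t *\<^sub>R v)"
proof -
  have e: "(norm ((d + (x * c) *\<^sub>R v) - (d' + (x * c') *\<^sub>R v)))\<^sup>2
      = (norm (d - d'))\<^sup>2 + 2 * x * ((c - c') * ((d - d') \<bullet> v)) + x\<^sup>2 * (norm (c *\<^sub>R v - c' *\<^sub>R v))\<^sup>2"
    for d d' c c'
  proof -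
    have "(d + (x * c) *\<^sub>R v) - (d' + (x * c') *\<^sub>R v) = (d - d') + (x * (c - c')) *\<^sub>R v"
      "c *\<^sub>R v - c' *\<^sub>R v = (c - c') *\<^sub>R v"
      by (simp_all add: algebra_simps)
    moreover have "(norm (u + y *\<^sub>R v))\<^sup>2 = (norm u)\<^sup>2 + 2 * y * (u \<bullet> v) + y\<^sup>2 * (norm v)\<^sup>2" for u y
      unfolding power2_norm_eq_inner
      by (simp add: algebra_simps inner_commute power2_eq_square)
    ultimately show ?thesis
      by (simp only: norm_scaleR power_mult_distrib power2_abs)
  qed
  show ?thesis
    unfolding dyadic_energy_def e sum.distrib sum_distrib_left[symmetric]
    by (simp only: distrib_left ac_simps)
qed

text \<open>Summation by parts: on its own grid the hat is a Kronecker delta, with increments 1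
  before the node and -1 after it. Applied to the increments of \<open>q\<close>, this yields minus
  a second difference.\<close>

lemma sum_hat_diff:
  fixes f :: "nat \<Rightarrow> real"
  assumes "0 < i" "i < 2 ^ k"
  shows "(\<Sum>j<2 ^ k. (hat k i (real (Suc j) / 2 ^ k) - hat k i (real j / 2 ^ k)) * f j)
    = f (i - 1) - f i"
proof -
  have "(\<Sum>j<2 ^ k. (hat k i (real (Suc j) / 2 ^ k) - hat k i (real j / 2 ^ k)) * f j)
      = (\<Sum>j<2 ^ k. (if j = i - 1 then f j else 0) - (if j = i then f j else 0))"
    unfolding hat_dyadic using assms(1) by (intro sum.cong) (auto simp del: of_nat_Suc)
  also have "\<dots> = f (i - 1) - f i"
    using assms by (simp add: sum_subtractf)
  finally show ?thesis .
qed

context strong_force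
begin

lemma minimizer_stationary:
  assumes min: "minimizer \<kappa> g q" and \<kappa>: "0 < \<kappa>" and i: "0 < i" "i < 2 ^ k"
  shows "(2 * \<kappa> * 2 ^ k) *\<^sub>R (q (real (i - 1) / 2 ^ k) - 2 *\<^sub>R q (real i / 2 ^ k)
      + q (real (Suc i) / 2 ^ k)) = integral {0..1} (\<lambda>t. hat k i t *\<^sub>R G (q t))"
    (is "?L = integral {0..1} ?H")
proof -
  obtain m where hom: "homotopic_paths S g q" and m: "\<And>k. action \<kappa> k q \<le> m"
    "\<And>p C k. homotopic_paths S g p \<Longrightarrow> \<forall>l\<ge>k. action \<kappa> l p \<le> C \<Longrightarrow> m \<le> C"
    using min unfolding minimizer_def by metis
  have pq: "path q" "path_image q \<subseteq> S"
    using hom homotopic_paths_imp_path homotopic_paths_imp_subset by blast+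
  then have cq: "continuous_on {0..1} q" and qS: "\<And>t. t \<in> {0..1} \<Longrightarrow> q t \<in> S"
    by (auto simp: path_def path_image_def)
  obtain e where "e > 0" and e: "\<And>h. path h \<Longrightarrow> pathstart h = pathstart q \<Longrightarrow>
      pathfinish h = pathfinish q \<Longrightarrow> (\<forall>t\<in>{0..1}. norm (h t - q t) < e) \<Longrightarrow> homotopic_paths S q h"
    using homotopic_nearby_paths[OF pq(1) open_S pq(2)] by blast
  have cH: "continuous_on {0..1} ?H"
    using qS by (intro continuous_intros continuous_hat continuous_on_compose2[OF continuous_G cq]) auto
  have "?L \<bullet> v = integral {0..1} ?H \<bullet> v" for v
  proof -
    \<comment> \<open>For \<open>\<bar>x\<bar> < d\<close> the perturbation stays below
      \<open>e\<close>, because hats are at most 1; the summand 1 covers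
      \<open>v = 0\<close>.\<close>
    define d where "d = e / (norm v + 1)"
    have "d > 0" using \<open>e > 0\<close> by (simp add: d_def add_nonneg_pos)
    define U where "U = {-d<..<d}"
    define p where "p x t = q t + (x * hat k i t) *\<^sub>R v" for x t
    have pn: "norm (p x t - q t) < e" if "x \<in> U" for x t
    proof -
      have "norm (p x t - q t) = \<bar>x\<bar> * hat k i t * norm v"
        by (simp add: p_def abs_mult hat_bounds)
      also have "\<dots> \<le> \<bar>x\<bar> * 1 * norm v"
        by (intro mult_left_mono mult_right_mono hat_bounds) auto
      also have "\<dots> \<le> \<bar>x\<bar> * (norm v + 1)" by (simp add: algebra_simps)
      also have "\<dots> < d * (norm v + 1)"
        using that by (intro mult_strict_right_mono) (auto simp: U_def add_nonneg_pos)
      also have "\<dots> = e"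
      proof -
        have "norm v + 1 \<noteq> 0" using norm_ge_zero[of v] by linarith
        then show ?thesis by (simp add: d_def)
      qed
      finally show ?thesis .
    qed
    have pp: "path (p x)" for x
      unfolding p_def path_def by (intro continuous_intros cq continuous_hat)
    have hp: "homotopic_paths S q (p x)" if "x \<in> U" for x
      using pn[OF that] pp
      by (intro e) (auto simp: pathstart_def pathfinish_def p_def hat_boundary[OF i])
    have pS: "p x t \<in> S" if "x \<in> U" "t \<in> {0..1}" for x t
      using homotopic_paths_imp_subset[OF hp[OF that(1)]] that(2) by (auto simp: path_image_def)
    let ?I = "\<lambda>x. integral {0..1} (\<lambda>t. W (p x t))"
    \<comment> \<open>The change of the action under the variation. It is computed at level
      \<open>k\<close> but valid at every level from \<open>k\<close> on, so \<open>m + F x\<close>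
      bounds the action of \<open>p x\<close> there.\<close>
    define F where "F x = \<kappa> * (dyadic_energy k (p x) - dyadic_energy k q) + (?I x - ?I 0)" for x
    have p0: "p 0 = q" by (simp add: p_def fun_eq_iff)
    have F0: "F 0 \<le> F x" if "x \<in> U" for x
    proof -
      have "action \<kappa> l (p x) \<le> m + F x" if "l \<ge> k" for l
      proof -
        have "dyadic_energy l (p x) - dyadic_energy l q = dyadic_energy k (p x) - dyadic_energy k q"
          unfolding p_def
        proof (rule dyadic_energy_add_affine[OF that])
          fix l' j assume "k \<le> l'"
          show "(x * hat k i (real (Suc (2 * j)) / 2 ^ Suc l')) *\<^sub>R v
            = ((x * hat k i (real j / 2 ^ l')) *\<^sub>R v + (x * hat k i (real (Suc j) / 2 ^ l')) *\<^sub>R v) /\<^sub>R 2"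
            unfolding hat_midpoint[OF \<open>k \<le> l'\<close>] scaleR_add_left[symmetric] scaleR_scaleR
            by (intro arg_cong[where f = "\<lambda>c. c *\<^sub>R v"]) (simp add: field_simps)
        qed
        then have eq: "dyadic_energy l (p x)
            = dyadic_energy l q + (dyadic_energy k (p x) - dyadic_energy k q)"
          by linarith
        have "action \<kappa> l (p x) = action \<kappa> l q + F x"
          unfolding action_def F_def p0 eq by (simp add: algebra_simps)
        with m(1)[of l] show ?thesis by simp
      qed
      then have "m \<le> m + F x"
        using homotopic_paths_trans[OF hom hp[OF that]] by (intro m(2)[of "p x" k]) simp_all
      then show ?thesis by (simp add: F_def p0)
    qed
    let ?D = "\<Sum>j<2 ^ k. (hat k i (real (Suc j) / 2 ^ k) - hat k i (real j / 2 ^ k))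
        * ((q (real (Suc j) / 2 ^ k) - q (real j / 2 ^ k)) \<bullet> v)"
    \<comment> \<open>Differentiation under the integral sign; restricting \<open>x\<close> to
      \<open>U\<close> keeps all points \<open>p x t\<close> in \<open>S\<close>, where
      \<open>W\<close> has the continuous gradient \<open>G\<close>.\<close>
    have "(?I has_field_derivative integral (cbox 0 1) (\<lambda>t. hat k i t * (v \<bullet> G (p 0 t)))) (at 0 within U)"
      unfolding cbox_interval[symmetric]
    proof (rule leibniz_rule_field_derivative)
      show "((\<lambda>x. W (p x t)) has_field_derivative hat k i t * (v \<bullet> G (p x t))) (at x within U)"
        if "x \<in> U" "t \<in> cbox 0 1" for x t
      proof -
        have "((\<lambda>x. p x t) has_derivative (\<lambda>h. (h * hat k i t) *\<^sub>R v)) (at x within U)"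
          unfolding p_def by (auto intro!: derivative_eq_intros)
        moreover have "(W has_derivative (\<lambda>h. h \<bullet> G (p x t))) (at (p x t))"
          using gradient[OF pS, of x t] that by (simp add: gderiv_def)
        ultimately have "((\<lambda>x. W (p x t)) has_derivative (\<lambda>h. ((h * hat k i t) *\<^sub>R v) \<bullet> G (p x t))) (at x within U)"
          by (rule has_derivative_compose)
        then show ?thesis
          by (simp add: has_field_derivative_def mult_commute_abs mult.assoc fun_eq_iff ac_simps)
      qed
      show "(\<lambda>t. W (p x t)) integrable_on cbox 0 1" if "x \<in> U" for x
        using integrable_W[OF pp homotopic_paths_imp_subset[OF hp[OF that], THEN conjunct2]] by simp
      have "continuous_on (U \<times> {0..1}) (\<lambda>z. p (fst z) (snd z))"
        unfolding p_def
        by (intro continuous_intros continuous_on_compose2[OF cq] continuous_on_compose2[OF continuous_hat]) auto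
      then show "continuous_on (U \<times> cbox 0 1) (\<lambda>(x, t). hat k i t * (v \<bullet> G (p x t)))"
        unfolding split_def cbox_interval using pS
        by (intro continuous_intros continuous_on_compose2[OF continuous_hat]
            continuous_on_compose2[OF continuous_G]) auto
    qed (use \<open>d > 0\<close> in \<open>auto simp: U_def\<close>)
    then have dI: "(?I has_field_derivative integral {0..1} ?H \<bullet> v) (at 0)"
      using at_within_open[of 0 U] \<open>d > 0\<close> integral_component_eq[OF integrable_continuous_real[OF cH]]
      by (simp add: U_def p0 inner_commute)
    have "(F has_field_derivative \<kappa> * (2 * 2 ^ k * ?D) + integral {0..1} ?H \<bullet> v) (at 0)"
      unfolding F_def p_def[abs_def, THEN meta_eq_to_obj_eq] dyadic_energy_perturb
      using dI by (auto intro!: derivative_eq_intros simp: p_def)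
    moreover have "\<forall>y. \<bar>0 - y\<bar> < d \<longrightarrow> F 0 \<le> F y"
      by (auto simp: U_def intro!: F0)
    ultimately have "\<kappa> * (2 * 2 ^ k * ?D) + integral {0..1} ?H \<bullet> v = 0"
      using DERIV_local_min \<open>d > 0\<close> by blast
    then show ?thesis
      unfolding sum_hat_diff[OF i] using i(1) by (simp add: algebra_simps)
  qed
  then show ?thesis
    using vector_eq_rdot by blast
qed

end

text \<open>The hat is the Peano kernel of the second difference. Integrating by parts on either
  side of the node leaves the terms \<open>F b\<close> and \<open>- F b\<close>, which
  cancel.\<close>

lemma second_difference_eq_hat_integral:
  fixes f :: "real \<Rightarrow> 'a::euclidean_space"
  assumes f: "continuous_on {0..1} f"
    and F: "\<And>t. t \<in> {0..1} \<Longrightarrow> (F has_vector_derivative f t) (at t within {0..1})"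
    and R: "\<And>t. t \<in> {0..1} \<Longrightarrow> (R has_vector_derivative F t) (at t within {0..1})"
    and i: "0 < i" "i < 2 ^ k"
  shows "2 ^ k *\<^sub>R (R (real (i - 1) / 2 ^ k) - 2 *\<^sub>R R (real i / 2 ^ k) + R (real (Suc i) / 2 ^ k))
    = integral {0..1} (\<lambda>t. hat k i t *\<^sub>R f t)"
proof -
  define a b c where "a = real (i - 1) / 2 ^ k" and "b = real i / 2 ^ k" and "c = real (Suc i) / 2 ^ k"
  have "real (Suc i) \<le> 2 ^ k"
    using i(2) by (metis Suc_leI of_nat_le_iff of_nat_numeral of_nat_power)
  then have abc: "0 \<le> a" "a \<le> b" "b \<le> c" "c \<le> 1"
    by (auto simp: a_def b_def c_def divide_right_mono)
  have a: "2 ^ k * a = real i - 1" "2 ^ k * b = real i" "2 ^ k * c = real i + 1"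
    using i(1) by (simp_all add: a_def b_def c_def of_nat_diff)
  have mono: "2 ^ k * s \<le> 2 ^ k * t \<longleftrightarrow> s \<le> t" for s t :: real by simp
  let ?h = "\<lambda>t. hat k i t *\<^sub>R f t"
  have 1: "(?h has_integral F b - 2 ^ k *\<^sub>R (R b - R a)) {a..b}"
  proof -
    have I: "((\<lambda>t. (2 ^ k * t - 2 ^ k * a) *\<^sub>R f t) has_integral
        ((2 ^ k * b - 2 ^ k * a) *\<^sub>R F b - 2 ^ k *\<^sub>R R b)
        - ((2 ^ k * a - 2 ^ k * a) *\<^sub>R F a - 2 ^ k *\<^sub>R R a)) {a..b}"
    proof (rule fundamental_theorem_of_calculus)
      fix t assume t: "t \<in> {a..b}"
      then have t01: "t \<in> {0..1}" and sub: "{a..b} \<subseteq> {0..1}" using abc by auto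
      note dF = has_vector_derivative_within_subset[OF F[OF t01] sub]
        and dR = has_vector_derivative_within_subset[OF R[OF t01] sub]
      show "((\<lambda>t. (2 ^ k * t - 2 ^ k * a) *\<^sub>R F t - 2 ^ k *\<^sub>R R t) has_vector_derivative
          (2 ^ k * t - 2 ^ k * a) *\<^sub>R f t) (at t within {a..b})"
        by (rule derivative_eq_intros dF dR refl | simp)+
    qed (rule abc)
    have hat: "hat k i t = 2 ^ k * t - 2 ^ k * a" if "t \<in> {a..b}" for t
      using that mono[of t b] mono[of a t] unfolding hat_def a by (auto simp: abs_if)
    have "2 ^ k * b - 2 ^ k * a = 1" unfolding a by simp
    then have val: "((2 ^ k * b - 2 ^ k * a) *\<^sub>R F b - 2 ^ k *\<^sub>R R b)
        - ((2 ^ k * a - 2 ^ k * a) *\<^sub>R F a - 2 ^ k *\<^sub>R R a) = F b - 2 ^ k *\<^sub>R (R b - R a)"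
      by (simp only:) (simp add: scaleR_diff_right)
    show ?thesis
      by (rule has_integral_eq[OF _ I[unfolded val]]) (simp only: hat)
  qed
  have 2: "(?h has_integral 2 ^ k *\<^sub>R (R c - R b) - F b) {b..c}"
  proof -
    have I: "((\<lambda>t. (2 ^ k * c - 2 ^ k * t) *\<^sub>R f t) has_integral
        ((2 ^ k * c - 2 ^ k * c) *\<^sub>R F c + 2 ^ k *\<^sub>R R c)
        - ((2 ^ k * c - 2 ^ k * b) *\<^sub>R F b + 2 ^ k *\<^sub>R R b)) {b..c}"
    proof (rule fundamental_theorem_of_calculus)
      fix t assume t: "t \<in> {b..c}"
      then have t01: "t \<in> {0..1}" and sub: "{b..c} \<subseteq> {0..1}" using abc by auto
      note dF = has_vector_derivative_within_subset[OF F[OF t01] sub]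
        and dR = has_vector_derivative_within_subset[OF R[OF t01] sub]
      show "((\<lambda>t. (2 ^ k * c - 2 ^ k * t) *\<^sub>R F t + 2 ^ k *\<^sub>R R t) has_vector_derivative
          (2 ^ k * c - 2 ^ k * t) *\<^sub>R f t) (at t within {b..c})"
        by (rule derivative_eq_intros dF dR refl | simp)+
    qed (rule abc)
    have hat: "hat k i t = 2 ^ k * c - 2 ^ k * t" if "t \<in> {b..c}" for t
      using that mono[of b t] mono[of t c] unfolding hat_def a by (auto simp: abs_if)
    have "2 ^ k * c - 2 ^ k * b = 1" unfolding a by simp
    then have val: "((2 ^ k * c - 2 ^ k * c) *\<^sub>R F c + 2 ^ k *\<^sub>R R c)
        - ((2 ^ k * c - 2 ^ k * b) *\<^sub>R F b + 2 ^ k *\<^sub>R R b) = 2 ^ k *\<^sub>R (R c - R b) - F b"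
      by (simp only:) (simp add: scaleR_diff_right)
    show ?thesis
      by (rule has_integral_eq[OF _ I[unfolded val]]) (simp only: hat)
  qed
  have 0: "(?h has_integral 0) {0..a}"
  proof (rule has_integral_is_0)
    fix t assume "t \<in> {0..a}"
    then show "?h t = 0"
      using mono[of t a] unfolding hat_def a by (auto simp: abs_if)
  qed
  have 3: "(?h has_integral 0) {c..1}"
  proof (rule has_integral_is_0)
    fix t assume "t \<in> {c..1}"
    then show "?h t = 0"
      using mono[of c t] unfolding hat_def a by (auto simp: abs_if)
  qed
  have "(?h has_integral (0 + (F b - 2 ^ k *\<^sub>R (R b - R a)) + (2 ^ k *\<^sub>R (R c - R b) - F b) + 0)) {0..1}"
    using abc
    by (intro has_integral_combine[OF _ _ _ 3] has_integral_combine[OF _ _ _ 2]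
        has_integral_combine[OF _ _ 0 1]) auto
  then have "integral {0..1} ?h = 0 + (F b - 2 ^ k *\<^sub>R (R b - R a)) + (2 ^ k *\<^sub>R (R c - R b) - F b) + 0"
    by (rule integral_unique)
  then show ?thesis
    unfolding a_def[symmetric] b_def[symmetric] c_def[symmetric]
    by (simp add: algebra_simps scaleR_2)
qed

text \<open>On each grid the values form an arithmetic progression; continuity carries the formula
  from the dyadic points to the interval.\<close>

lemma affine_of_second_differences:
  fixes d :: "real \<Rightarrow> 'a::real_normed_vector"
  assumes d: "continuous_on {0..1} d"
    and diff: "\<And>k i. 0 < i \<Longrightarrow> i < 2 ^ k \<Longrightarrow>
      d (real (i - 1) / 2 ^ k) - 2 *\<^sub>R d (real i / 2 ^ k) + d (real (Suc i) / 2 ^ k) = 0"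
    and t: "t \<in> {0..1}"
  shows "d t = d 0 + t *\<^sub>R (d 1 - d 0)"
proof -
  have dyadic: "d (real j / 2 ^ k) = d 0 + (real j / 2 ^ k) *\<^sub>R (d 1 - d 0)" if "j \<le> 2 ^ k" for j k
  proof -
    let ?x = "\<lambda>j. d (real j / 2 ^ k)"
    have lin: "?x j = d 0 + real j *\<^sub>R (?x 1 - d 0)" if "j \<le> 2 ^ k" for j
      using that
    proof (induction j rule: less_induct)
      case (less j)
      consider "j = 0" | "j = 1" | i where "j = Suc i" "0 < i"
        by (cases j) auto
      then show ?case
      proof cases
        case 3
        then have "?x (i - 1) - 2 *\<^sub>R ?x i + ?x (Suc i) = 0"
          using less.prems by (intro diff) auto
        then have "?x (Suc i) = 2 *\<^sub>R ?x i - ?x (i - 1)"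
          by (simp add: algebra_simps)
        moreover have "?x i = d 0 + real i *\<^sub>R (?x 1 - d 0)"
          "?x (i - 1) = d 0 + (real i - 1) *\<^sub>R (?x 1 - d 0)"
          using less.IH[of i] less.IH[of "i - 1"] less.prems 3 by (auto simp: of_nat_diff)
        ultimately have "?x (Suc i) = 2 *\<^sub>R (d 0 + real i *\<^sub>R (?x 1 - d 0)) - (d 0 + (real i - 1) *\<^sub>R (?x 1 - d 0))"
          by (simp only:)
        also have "\<dots> = d 0 + real (Suc i) *\<^sub>R (?x 1 - d 0)"
          unfolding scaleR_2 by (simp add: algebra_simps)
        finally show ?thesis using 3 by simp
      qed auto
    qed
    \<comment> \<open>The last grid point expresses the increment through the end values, which
      makes the formula independent of \<open>k\<close>.\<close>
    have "d 1 - d 0 = 2 ^ k *\<^sub>R (?x 1 - d 0)"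
      using lin[of "2 ^ k"] by simp
    then show ?thesis using lin[OF that] by simp
  qed
  show ?thesis
  proof (rule LIMSEQ_unique)
    let ?f = "\<lambda>k. real (nat \<lfloor>t * 2 ^ k\<rfloor>) / 2 ^ k"
    show "(\<lambda>k. d (?f k)) \<longlonglongrightarrow> d t"
      by (rule continuous_dyadic_approx[OF d t])
    have "(\<lambda>k. d 0 + ?f k *\<^sub>R (d 1 - d 0)) \<longlonglongrightarrow> d 0 + t *\<^sub>R (d 1 - d 0)"
      using dyadic_approx[of t] t by (intro tendsto_intros) (auto simp: max_def)
    then show "(\<lambda>k. d (?f k)) \<longlonglongrightarrow> d 0 + t *\<^sub>R (d 1 - d 0)"
      using t by (simp only: dyadic dyadic_floor_le(2)[of t t] atLeastAtMost_iff)
  qed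
qed

context strong_force
begin

text \<open>A discrete du Bois-Reymond argument: \<open>q\<close> differs from a double primitive
  \<open>R\<close> of the rescaled force by an affine function, and so inherits the regularity of
  \<open>R\<close>.\<close>

theorem strong_force_dirichlet:
  assumes g: "path g" "path_image g \<subseteq> S" and \<kappa>: "0 < \<kappa>"
  obtains q v where "homotopic_paths S g q"
    "\<And>t. t \<in> {0..1} \<Longrightarrow> (q has_vector_derivative v t) (at t within {0..1})"
    "\<And>t. t \<in> {0..1} \<Longrightarrow> (v has_vector_derivative G (q t) /\<^sub>R (2 * \<kappa>)) (at t within {0..1})"
proof -
  obtain q where q: "minimizer \<kappa> g q"
    using exists_minimizer[OF g \<kappa>] by blast
  then have hom: "homotopic_paths S g q" by (simp add: minimizer_def)
  then have "path q" "path_image q \<subseteq> S"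
    using homotopic_paths_imp_path homotopic_paths_imp_subset by blast+
  then have cq: "continuous_on {0..1} q" and qS: "\<And>t. t \<in> {0..1} \<Longrightarrow> q t \<in> S"
    by (auto simp: path_def path_image_def)
  \<comment> \<open>The divisor \<open>2 * \<kappa>\<close> arises from differentiating the
    quadratic energy with coefficient \<open>\<kappa>\<close>.\<close>
  define f where "f t = G (q t) /\<^sub>R (2 * \<kappa>)" for t
  have cf: "continuous_on {0..1} f"
    unfolding f_def using qS
    by (intro continuous_intros continuous_on_compose2[OF continuous_G cq]) auto
  define F where "F t = integral {0..t} f" for t
  have F: "(F has_vector_derivative f t) (at t within {0..1})" if "t \<in> {0..1}" for t
    unfolding F_def using integral_has_vector_derivative[OF cf that] .
  have cF: "continuous_on {0..1} F"
    using F has_vector_derivative_continuous continuous_on_eq_continuous_within by blast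
  define R where "R t = integral {0..t} F" for t
  have R: "(R has_vector_derivative F t) (at t within {0..1})" if "t \<in> {0..1}" for t
    unfolding R_def using integral_has_vector_derivative[OF cF that] .
  have cR: "continuous_on {0..1} R"
    using R has_vector_derivative_continuous continuous_on_eq_continuous_within by blast
  define d where "d t = q t - R t" for t
  have "d t = d 0 + t *\<^sub>R (d 1 - d 0)" if "t \<in> {0..1}" for t
  proof (rule affine_of_second_differences[OF _ _ that])
    show "continuous_on {0..1} d"
      unfolding d_def by (intro continuous_intros cq cR)
    fix k i :: nat assume i: "0 < i" "i < 2 ^ k"
    let ?D = "\<lambda>q. q (real (i - 1) / 2 ^ k) - 2 *\<^sub>R q (real i / 2 ^ k) + q (real (Suc i) / 2 ^ k)"
    have "2 ^ k *\<^sub>R ?D R = integral {0..1} (\<lambda>t. hat k i t *\<^sub>R f t)"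
      by (rule second_difference_eq_hat_integral[OF cf F R i])
    then have "(2 * \<kappa>) *\<^sub>R (2 ^ k *\<^sub>R ?D R) = integral {0..1} (\<lambda>t. (2 * \<kappa>) *\<^sub>R hat k i t *\<^sub>R f t)"
      by (simp only: Henstock_Kurzweil_Integration.integral_cmul)
    also have "\<dots> = integral {0..1} (\<lambda>t. hat k i t *\<^sub>R G (q t))"
      using \<kappa> by (simp add: f_def field_simps)
    also have "\<dots> = (2 * \<kappa> * 2 ^ k) *\<^sub>R ?D q"
      using minimizer_stationary[OF q \<kappa> i] by simp
    finally have "(2 * \<kappa> * 2 ^ k) *\<^sub>R ?D R = (2 * \<kappa> * 2 ^ k) *\<^sub>R ?D q"
      by (simp only: scaleR_scaleR)
    then have "?D R = ?D q"
      using \<kappa> by (simp only: scaleR_cancel_left) simp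
    then show "?D d = 0"
      unfolding d_def by (simp add: algebra_simps)
  qed
  then have eq: "q t = R t + (d 0 + t *\<^sub>R (d 1 - d 0))" if "t \<in> {0..1}" for t
    using that by (metis add.commute d_def diff_add_cancel)
  show ?thesis
  proof (rule that[OF hom])
    fix t :: real assume t: "t \<in> {0..1}"
    have "((\<lambda>t. R t + (d 0 + t *\<^sub>R (d 1 - d 0))) has_vector_derivative F t + (d 1 - d 0)) (at t within {0..1})"
      by (rule derivative_eq_intros R[OF t] refl | simp)+
    then show "(q has_vector_derivative F t + (d 1 - d 0)) (at t within {0..1})"
      by (rule has_vector_derivative_transform[OF t, rotated]) (rule eq)
    show "((\<lambda>t. F t + (d 1 - d 0)) has_vector_derivative G (q t) /\<^sub>R (2 * \<kappa>)) (at t within {0..1})"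
      using F[OF t] unfolding f_def by (auto intro!: derivative_eq_intros)
  qed
qed

end

subsection \<open>Powers of loops\<close>

lemma loop_power_ends [simp]:
  assumes "pathfinish p = pathstart p"
  shows "pathstart (loop_power p m) = pathstart p" "pathfinish (loop_power p m) = pathstart p"
proof -
  have "pathstart (loop_power p m) = pathstart p \<and> pathfinish (loop_power p m) = pathstart p"
    using assms
  proof (induction p m rule: loop_power.induct)
    case (1 p)
    then show ?case by (simp add: pathstart_def pathfinish_def)
  qed simp_all
  then show "pathstart (loop_power p m) = pathstart p" "pathfinish (loop_power p m) = pathstart p"
    by auto
qed

lemma loop_power_path:
  assumes "path p" "path_image p \<subseteq> S" "pathfinish p = pathstart p"
  shows "path (loop_power p m)" "path_image (loop_power p m) \<subseteq> S"
proof -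
  have "pathstart p \<in> S" using assms(2) pathstart_in_path_image by blast
  then have "path (loop_power p m) \<and> path_image (loop_power p m) \<subseteq> S"
    using assms
  proof (induction p m rule: loop_power.induct)
    case (1 p)
    then show ?case by (auto simp: path_def path_image_def)
  next
    case (3 p k)
    then show ?case by (auto simp: path_image_join)
  qed auto
  then show "path (loop_power p m)" "path_image (loop_power p m) \<subseteq> S" by auto
qed

lemma homotopic_loop_power:
  assumes "homotopic_paths S p q" "pathfinish p = pathstart p" "1 \<le> m"
  shows "homotopic_paths S (loop_power p m) (loop_power q m)"
  using assms(3)
proof (induction m rule: dec_induct)
  case (step m)
  note ends = homotopic_paths_imp_pathstart[OF assms(1)] homotopic_paths_imp_pathfinish[OF assms(1)]
  show ?case
    using step homotopic_paths_join[OF assms(1) step.IH] assms(2) ends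
    by (cases m) (auto simp del: homotopic_paths_join)
qed (use assms in simp)

text \<open>Reversal moves the first factor to the end, whereas \<open>loop_power\<close> adds
  factors in front; this lemma brings it back.\<close>

lemma loop_power_commute:
  assumes "path p" "path_image p \<subseteq> S" "pathfinish p = pathstart p" "1 \<le> m"
  shows "homotopic_paths S (loop_power p m +++ p) (p +++ loop_power p m)"
  using assms(4)
proof (induction m rule: dec_induct)
  case base
  then show ?case using assms by (auto simp: path_image_join)
next
  case (step m)
  let ?P = "loop_power p m"
  have P: "path ?P" "path_image ?P \<subseteq> S" "pathstart ?P = pathstart p" "pathfinish ?P = pathstart p"
    using loop_power_path[OF assms(1-3)] assms(3) by auto
  have eq: "loop_power p (Suc m) = p +++ ?P" using step by (cases m) auto
  have "homotopic_paths S ((p +++ ?P) +++ p) (p +++ (?P +++ p))"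
    using homotopic_paths_assoc[of p S ?P p] assms P homotopic_paths_sym by auto
  moreover have "homotopic_paths S (p +++ (?P +++ p)) (p +++ (p +++ ?P))"
    using assms P by (intro homotopic_paths_join[OF _ step.IH]) auto
  ultimately show ?case
    unfolding eq using homotopic_paths_trans by blast
qed

lemma reversepath_loop_power:
  assumes "path p" "path_image p \<subseteq> S" "pathfinish p = pathstart p" "1 \<le> m"
  shows "homotopic_paths S (reversepath (loop_power p m)) (loop_power (reversepath p) m)"
  using assms(4)
proof (induction m rule: dec_induct)
  case base
  then show ?case using assms by auto
next
  case (step m)
  let ?P = "loop_power p m" and ?r = "reversepath p"
  have P: "pathstart ?P = pathstart p" "pathfinish ?P = pathstart p"
    using assms(3) by auto
  have eq: "loop_power p (Suc m) = p +++ ?P" "loop_power ?r (Suc m) = ?r +++ loop_power ?r m"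
    using step by (cases m; auto)+
  have "reversepath (p +++ ?P) = reversepath ?P +++ ?r"
    using P assms(3) by (intro reversepath_joinpaths) auto
  moreover have "homotopic_paths S (reversepath ?P +++ ?r) (loop_power ?r m +++ ?r)"
    using step.IH assms P by (intro homotopic_paths_join) auto
  moreover have "homotopic_paths S (loop_power ?r m +++ ?r) (?r +++ loop_power ?r m)"
    using assms step.hyps by (intro loop_power_commute) auto
  ultimately show ?case
    unfolding eq using homotopic_paths_trans by metis
qed

lemma loop_power_compose: "f \<circ> loop_power p m = loop_power (f \<circ> p) m"
proof (induction p m rule: loop_power.induct)
  case (1 p)
  then show ?case by (auto simp: pathstart_def)
next
  case (3 p k)
  then show ?case by (simp only: loop_power.simps path_compose_join)
qed simp

subsection \<open>The loops \<open>\<alpha>\<close> and \<open>\<beta>\<close>\<close>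

lemma continuous_circle_loop: "continuous_on A (circle_loop \<sigma> c a)"
proof -
  have "continuous_on A (\<lambda>t. rotate_by (\<sigma> * 2 * pi * t) x)" for x :: "real^2"
  proof -
    have "continuous_on A (\<lambda>t. \<chi> i. if i = 1
        then cos (\<sigma> * 2 * pi * t) * x$1 - sin (\<sigma> * 2 * pi * t) * x$2
        else sin (\<sigma> * 2 * pi * t) * x$1 + cos (\<sigma> * 2 * pi * t) * x$2 :: real^2)"
    proof (rule continuous_on_vec_lambda)
      fix i :: 2
      show "continuous_on A (\<lambda>t. if i = 1
          then cos (\<sigma> * 2 * pi * t) * x$1 - sin (\<sigma> * 2 * pi * t) * x$2
          else sin (\<sigma> * 2 * pi * t) * x$1 + cos (\<sigma> * 2 * pi * t) * x$2)"
        by (cases "i = 1") (auto intro!: continuous_intros)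
    qed
    moreover have "rotate_by \<theta> x = (\<chi> i. if i = 1 then cos \<theta> * x$1 - sin \<theta> * x$2
        else sin \<theta> * x$1 + cos \<theta> * x$2)" for \<theta>
      by (simp add: rotate_by_def vec_eq_iff forall_2)
    ultimately show ?thesis by simp
  qed
  then show ?thesis
    unfolding circle_loop_def by (intro continuous_intros)
qed

lemma path_circle_loop: "path (circle_loop \<sigma> c a)"
  by (simp add: path_def continuous_circle_loop)

lemma norm_rotate_by: "norm (rotate_by \<theta> x) = norm x"
proof -
  have "(norm (rotate_by \<theta> x))\<^sup>2
      = (cos \<theta> * x$1 - sin \<theta> * x$2)\<^sup>2 + (sin \<theta> * x$1 + cos \<theta> * x$2)\<^sup>2"
    unfolding power2_norm_eq_inner by (simp add: inner_vec_def sum_2 rotate_by_def power2_eq_square)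
  also have "\<dots> = ((sin \<theta>)\<^sup>2 + (cos \<theta>)\<^sup>2) * ((x$1)\<^sup>2 + (x$2)\<^sup>2)"
    by algebra
  also have "\<dots> = (x$1)\<^sup>2 + (x$2)\<^sup>2"
    by simp
  also have "\<dots> = (norm x)\<^sup>2"
    unfolding power2_norm_eq_inner by (simp add: inner_vec_def sum_2 power2_eq_square)
  finally show ?thesis by simp
qed

lemma rotate_by_0 [simp]: "rotate_by 0 x = x"
  by (simp add: rotate_by_def vec_eq_iff forall_2)

lemma rotate_by_2pi [simp]: "rotate_by (2 * pi) x = x" "rotate_by (- (2 * pi)) x = x"
  by (simp_all add: rotate_by_def vec_eq_iff forall_2)

lemma rotate_by_minus: "rotate_by \<theta> (- x) = - rotate_by \<theta> x"
  by (simp add: rotate_by_def vec_eq_iff forall_2)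

lemma rotate_by_periodic: "rotate_by (\<theta> - 2 * pi) x = rotate_by \<theta> x"
  by (simp add: rotate_by_def sin_diff cos_diff)

lemma circle_loop_ends [simp]:
  "pathstart (circle_loop 1 c a) = a" "pathfinish (circle_loop 1 c a) = a"
  "pathstart (circle_loop (- 1) c a) = a" "pathfinish (circle_loop (- 1) c a) = a"
  by (simp_all add: pathstart_def pathfinish_def circle_loop_def)

lemma alpha_loop_ends [simp]: "pathstart (alpha_loop r0) = 0" "pathfinish (alpha_loop r0) = 0"
  by (simp_all add: alpha_loop_def)

lemma beta_loop_ends [simp]: "pathstart (beta_loop r0) = 0" "pathfinish (beta_loop r0) = 0"
  by (simp_all add: beta_loop_def)

lemma path_alpha_loop: "path (alpha_loop r0)"
  unfolding alpha_loop_def by (simp add: path_circle_loop)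

lemma path_image_alpha_loop:
  assumes "r0 \<noteq> 0"
  shows "path_image (alpha_loop r0) \<subseteq> config_space r0"
proof -
  have n: "norm r0 > 0" using assms by simp
  have sub: "closed_segment 0 (r0 /\<^sub>R 2) \<subseteq> cball 0 (norm r0 / 2)"
    by (intro closed_segment_subset) auto
  have seg: "norm x < norm r0" if "x \<in> closed_segment 0 (r0 /\<^sub>R 2)" for x
  proof -
    have "norm x \<le> norm r0 / 2" using subsetD[OF sub that] by simp
    with n show ?thesis by linarith
  qed
  have circ: "circle_loop (- 1) r0 (r0 /\<^sub>R 2) t \<noteq> r0" "circle_loop (- 1) r0 (r0 /\<^sub>R 2) t \<noteq> - r0" for t
  proof -
    have d: "norm (circle_loop (- 1) r0 (r0 /\<^sub>R 2) t - r0) = norm r0 / 2"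
    proof -
      have "r0 /\<^sub>R 2 - r0 = - (r0 /\<^sub>R 2)" by (simp add: vec_eq_iff)
      then show ?thesis
        unfolding circle_loop_def by (simp only: add_diff_cancel_left' norm_rotate_by) simp
    qed
    then show "circle_loop (- 1) r0 (r0 /\<^sub>R 2) t \<noteq> r0" using n by auto
    have "norm (- r0 - r0) = 2 * norm r0"
      by (metis norm_minus_cancel minus_diff_eq diff_minus_eq_add norm_scaleR scaleR_2 abs_numeral)
    then show "circle_loop (- 1) r0 (r0 /\<^sub>R 2) t \<noteq> - r0" using d n by auto
  qed
  have "path_image (circle_loop (- 1) r0 (r0 /\<^sub>R 2)) \<subseteq> config_space r0"
    using circ by (auto simp: path_image_def config_space_def)
  moreover have "closed_segment 0 (r0 /\<^sub>R 2) \<subseteq> config_space r0"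
    "closed_segment (r0 /\<^sub>R 2) 0 \<subseteq> config_space r0"
    using seg[of r0] seg[of "- r0"] by (auto simp: config_space_def closed_segment_commute)
  ultimately show ?thesis
    unfolding alpha_loop_def by (simp add: path_image_join)
qed

text \<open>Reversal turns the clockwise circle into a counterclockwise one. The point reflection is
  a rotation of the plane, so it keeps this orientation while moving the centre to
  \<open>- r0\<close>. The two loops differ only in the bracketing of their three pieces.\<close>

lemma minus_reversepath_alpha_loop:
  assumes "r0 \<noteq> 0"
  shows "homotopic_paths (config_space r0) (uminus \<circ> reversepath (alpha_loop r0)) (beta_loop r0)"
proof -
  let ?h = "r0 /\<^sub>R 2" and ?c = "circle_loop (- 1) r0 (r0 /\<^sub>R 2)"
  let ?l = "linepath 0 (- r0 /\<^sub>R 2)" and ?l' = "linepath (- r0 /\<^sub>R 2) 0"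
    and ?c' = "circle_loop 1 (- r0) (- r0 /\<^sub>R 2)"
  have c: "uminus \<circ> reversepath ?c = ?c'"
  proof
    fix t
    have "- ?c (1 - t) = - r0 - rotate_by (2 * pi * t - 2 * pi) (?h - r0)"
      by (simp add: circle_loop_def algebra_simps)
    also have "\<dots> = - r0 + rotate_by (2 * pi * t) (- (?h - r0))"
      unfolding rotate_by_periodic rotate_by_minus by simp
    also have "\<dots> = ?c' t"
      by (simp add: circle_loop_def)
    finally show "(uminus \<circ> reversepath ?c) t = ?c' t"
      by (simp only: reversepath_def o_apply)
  qed
  have l: "uminus \<circ> linepath 0 ?h = ?l" "uminus \<circ> linepath ?h 0 = ?l'"
    by (auto simp: linepath_def fun_eq_iff)
  have eq: "uminus \<circ> reversepath (alpha_loop r0) = (?l +++ ?c') +++ ?l'"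
    unfolding alpha_loop_def
    by (simp only: reversepath_joinpaths path_compose_join c l reversepath_linepath
        pathstart_join pathfinish_join pathstart_linepath pathfinish_linepath circle_loop_ends)
  have im: "path_image (uminus \<circ> reversepath (alpha_loop r0)) \<subseteq> config_space r0"
    using path_image_alpha_loop[OF assms] unfolding path_image_compose path_image_reversepath
    by (auto simp: config_space_def)
  then have "path_image ?l \<subseteq> config_space r0" "path_image ?c' \<subseteq> config_space r0" "path_image ?l' \<subseteq> config_space r0"
    unfolding eq by (simp_all add: path_image_join)
  then show ?thesis
    unfolding eq beta_loop_def
    by (intro homotopic_paths_sym[OF homotopic_paths_assoc])
      (simp_all add: path_circle_loop)
qed

lemma odd_double_homotopic:
  assumes r0: "r0 \<noteq> 0" and m: "1 \<le> m"
    and q: "homotopic_paths (config_space r0) (loop_power (alpha_loop r0) m) q"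
  shows "homotopic_loops (config_space r0) (q +++ (uminus \<circ> reversepath q))
    (loop_power (alpha_loop r0) m +++ loop_power (beta_loop r0) m)"
proof -
  let ?S = "config_space r0" and ?\<alpha> = "alpha_loop r0" and ?\<beta> = "beta_loop r0"
  note \<alpha> = path_alpha_loop[of r0] path_image_alpha_loop[OF r0]
  have um: "continuous_on ?S uminus" "uminus \<in> ?S \<rightarrow> ?S"
    by (auto intro!: continuous_intros simp: config_space_def)
  have "homotopic_paths ?S (reversepath q) (reversepath (loop_power ?\<alpha> m))"
    using homotopic_paths_sym[OF q] by (simp add: homotopic_paths_reversepath)
  moreover have "homotopic_paths ?S (reversepath (loop_power ?\<alpha> m)) (loop_power (reversepath ?\<alpha>) m)"
    using \<alpha> m by (intro reversepath_loop_power) auto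
  ultimately have "homotopic_paths ?S (reversepath q) (loop_power (reversepath ?\<alpha>) m)"
    by (rule homotopic_paths_trans)
  from homotopic_paths_continuous_image[OF this um]
  have "homotopic_paths ?S (uminus \<circ> reversepath q) (loop_power (uminus \<circ> reversepath ?\<alpha>) m)"
    by (simp add: loop_power_compose)
  moreover have "homotopic_paths ?S (loop_power (uminus \<circ> reversepath ?\<alpha>) m) (loop_power ?\<beta> m)"
    using m by (intro homotopic_loop_power minus_reversepath_alpha_loop r0)
      (auto simp: pathstart_compose pathfinish_compose)
  ultimately have "homotopic_paths ?S (uminus \<circ> reversepath q) (loop_power ?\<beta> m)"
    by (rule homotopic_paths_trans)
  moreover have ends: "pathstart q = 0" "pathfinish q = 0"
    using homotopic_paths_imp_pathstart[OF q] homotopic_paths_imp_pathfinish[OF q] by auto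
  ultimately have h: "homotopic_paths ?S (q +++ (uminus \<circ> reversepath q))
      (loop_power ?\<alpha> m +++ loop_power ?\<beta> m)"
    using homotopic_paths_sym[OF q] by (intro homotopic_paths_join)
      (auto simp: pathstart_compose)
  show ?thesis
    using ends by (intro homotopic_paths_imp_homotopic_loops[OF h]) (auto simp: pathfinish_compose)
qed

subsection \<open>Odd periodic extension\<close>

text \<open>The even (\<open>\<sigma> = 1\<close>) or odd (\<open>\<sigma> = - 1\<close>) extension about every integer. The odd one takes
  the value \<open>- h 1\<close> at \<open>1\<close>, so it extends \<open>h\<close> only if \<open>h 1 = 0\<close>.\<close>

definition reflect :: "real \<Rightarrow> (real \<Rightarrow> 'a::real_vector) \<Rightarrow> real \<Rightarrow> 'a" where
  "reflect \<sigma> h s = (if even \<lfloor>s\<rfloor> then h (frac s) else \<sigma> *\<^sub>R h (1 - frac s))"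

lemma reflect_periodic: "reflect \<sigma> h (s + 2) = reflect \<sigma> h s"
proof -
  have "\<lfloor>s + 2\<rfloor> = \<lfloor>s\<rfloor> + 2" by linarith
  then show ?thesis by (simp add: reflect_def frac_def)
qed

text \<open>At the right end of the closed interval the definition already uses the next formula;
  the hypothesis on \<open>\<sigma>\<close> makes both agree there.\<close>

lemma reflect_segment:
  assumes \<sigma>: "\<sigma> = 1 \<or> h 0 = 0 \<and> h 1 = 0 \<and> \<sigma> = - 1" and s: "s \<in> {of_int k..of_int k + 1}"
  shows "reflect \<sigma> h s = (if even k then h (s - of_int k) else \<sigma> *\<^sub>R h (of_int k + 1 - s))"
proof (cases "s = of_int k + 1")
  case True
  then have "\<lfloor>s\<rfloor> = k + 1" by simp
  with True \<sigma> show ?thesis by (auto simp: reflect_def frac_def)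
next
  case False
  with s have "\<lfloor>s\<rfloor> = k" by (simp add: floor_eq_iff)
  then show ?thesis by (simp add: reflect_def frac_def algebra_simps)
qed

text \<open>At an integer the one-sided derivatives from the two adjacent intervals coincide, and
  these intervals together form a neighbourhood.\<close>

lemma has_vector_derivative_unit_intervals:
  fixes f :: "real \<Rightarrow> 'a::real_normed_vector"
  assumes "\<And>k x. x \<in> {of_int k..of_int k + 1} \<Longrightarrow>
    (f has_vector_derivative f' x) (at x within {of_int k..of_int k + 1})"
  shows "(f has_vector_derivative f' x) (at x)"
proof (cases "x = of_int \<lfloor>x\<rfloor>")
  case False
  then have x: "x \<in> interior {of_int \<lfloor>x\<rfloor>..of_int \<lfloor>x\<rfloor> + 1}"
    by (simp add: interior_atLeastAtMost_real, linarith)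
  then have "at x within {of_int \<lfloor>x\<rfloor>..of_int \<lfloor>x\<rfloor> + 1} = at x"
    by (rule at_within_interior)
  moreover have "x \<in> {of_int \<lfloor>x\<rfloor>..of_int \<lfloor>x\<rfloor> + 1}"
    using x interior_subset by blast
  ultimately show ?thesis using assms by metis
next
  case True
  let ?k = "\<lfloor>x\<rfloor>"
  have "(f has_vector_derivative f' x) (at x within {of_int ?k..of_int ?k + 1})"
    using True by (intro assms) auto
  moreover have "(f has_vector_derivative f' x) (at x within {of_int (?k - 1)..of_int (?k - 1) + 1})"
    using True by (intro assms) auto
  ultimately have "(f has_vector_derivative f' x)
      (at x within {of_int ?k..of_int ?k + 1} \<union> {of_int (?k - 1)..of_int (?k - 1) + 1})"
    unfolding has_vector_derivative_def has_derivative_within by (auto intro: Lim_Un)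
  moreover have "x \<in> interior ({of_int ?k..of_int ?k + 1} \<union> {of_int (?k - 1)..of_int (?k - 1) + 1})"
  proof -
    have "{of_int ?k..of_int ?k + 1} \<union> {of_int (?k - 1)..of_int (?k - 1) + 1} = {x - 1..x + 1}"
      using True by auto
    then show ?thesis by (simp add: interior_atLeastAtMost_real)
  qed
  ultimately show ?thesis
    by (simp only: at_within_interior)
qed

text \<open>Differentiation changes the parity. Whichever of \<open>h\<close> and \<open>h'\<close>
  is continued oddly has to vanish at both ends.\<close>

lemma has_vector_derivative_reflect:
  fixes h :: "real \<Rightarrow> 'a::real_normed_vector"
  assumes h: "\<And>t. t \<in> {0..1} \<Longrightarrow> (h has_vector_derivative h' t) (at t within {0..1})"
    and \<sigma>: "\<sigma> = - 1 \<and> h 0 = 0 \<and> h 1 = 0 \<or> \<sigma> = 1 \<and> h' 0 = 0 \<and> h' 1 = 0"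
  shows "(reflect \<sigma> h has_vector_derivative reflect (- \<sigma>) h' s) (at s)"
proof (rule has_vector_derivative_unit_intervals)
  fix k :: int and x :: real
  let ?I = "{of_int k..of_int k + 1 :: real}"
  assume x: "x \<in> ?I"
  have seg: "reflect \<sigma> h s = (if even k then h (s - of_int k) else \<sigma> *\<^sub>R h (of_int k + 1 - s))"
    "reflect (- \<sigma>) h' s = (if even k then h' (s - of_int k) else - \<sigma> *\<^sub>R h' (of_int k + 1 - s))"
    if "s \<in> ?I" for s
    using that \<sigma> by (intro reflect_segment; auto)+
  show "(reflect \<sigma> h has_vector_derivative reflect (- \<sigma>) h' x) (at x within ?I)"
  proof (rule has_vector_derivative_transform[OF x seg(1)])
    show "((\<lambda>s. if even k then h (s - of_int k) else \<sigma> *\<^sub>R h (of_int k + 1 - s)) has_vector_derivative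
        reflect (- \<sigma>) h' x) (at x within ?I)"
    proof (cases "even k")
      case True
      have "((h \<circ> (\<lambda>s. s - of_int k)) has_vector_derivative 1 *\<^sub>R h' (x - of_int k)) (at x within ?I)"
      proof (rule vector_diff_chain_within)
        show "((\<lambda>s. s - of_int k) has_vector_derivative 1) (at x within ?I)"
          by (auto intro!: derivative_eq_intros)
        show "(h has_vector_derivative h' (x - of_int k)) (at (x - of_int k) within (\<lambda>s. s - of_int k) ` ?I)"
          using x by (intro has_vector_derivative_within_subset[OF h]) auto
      qed
      then show ?thesis using True x by (simp add: seg o_def)
    next
      case False
      have "((h \<circ> (\<lambda>s. of_int k + 1 - s)) has_vector_derivative (- 1) *\<^sub>R h' (of_int k + 1 - x)) (at x within ?I)"
      proof (rule vector_diff_chain_within)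
        show "((\<lambda>s. of_int k + 1 - s) has_vector_derivative - 1) (at x within ?I)"
          by (auto intro!: derivative_eq_intros)
        show "(h has_vector_derivative h' (of_int k + 1 - x))
            (at (of_int k + 1 - x) within (\<lambda>s. of_int k + 1 - s) ` ?I)"
          using x by (intro has_vector_derivative_within_subset[OF h]) auto
      qed
      then have "((\<lambda>s. \<sigma> *\<^sub>R h (of_int k + 1 - s)) has_vector_derivative
          \<sigma> *\<^sub>R ((- 1) *\<^sub>R h' (of_int k + 1 - x))) (at x within ?I)"
        unfolding o_def has_vector_derivative_def
        by (intro has_derivative_scaleR_right[THEN has_derivative_eq_rhs]) (auto simp: ac_simps)
      then show ?thesis using False x by (simp add: seg)
    qed
  qed
qed

lemma has_vector_derivative_rescale:
  assumes "(f has_vector_derivative f') (at (t / T))" "T \<noteq> 0"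
  shows "((\<lambda>t. f (t / T)) has_vector_derivative f' /\<^sub>R T) (at t)"
proof -
  have "((f \<circ> (\<lambda>t. t / T)) has_vector_derivative inverse T *\<^sub>R f') (at t)"
    using assms by (intro vector_diff_chain_at) (auto intro!: derivative_eq_intros simp: field_simps)
  then show ?thesis by (simp add: o_def)
qed

subsection \<open>The two-centre potential\<close>

definition centre_gradient :: "real \<Rightarrow> 'a::real_normed_vector \<Rightarrow> 'a" where
  "centre_gradient n y = (- n / norm y powr (n + 2)) *\<^sub>R y"

lemma GDERIV_inverse_norm_powr:
  fixes c x :: "'a::real_inner"
  assumes "x \<noteq> c"
  shows "GDERIV (\<lambda>x. 1 / norm (x - c) powr n) x :> centre_gradient n (x - c)"
proof -
  have pos: "0 < norm (x - c)" using assms by simp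
  have 1: "((\<lambda>x. norm (x - c)) has_derivative (\<lambda>h. h \<bullet> sgn (x - c))) (at x)"
    using GDERIV_norm[of "x - c"] assms unfolding gderiv_def
    by (auto intro!: derivative_eq_intros has_derivative_compose[of "\<lambda>x. x - c" _ x UNIV norm])
  then have 1: "GDERIV (\<lambda>x. norm (x - c)) x :> sgn (x - c)"
    by (simp add: gderiv_def)
  have 2: "DERIV (\<lambda>y. y powr (- n)) (norm (x - c)) :> - n * norm (x - c) powr (- n - 1)"
    using pos by (rule has_real_derivative_powr)
  have "centre_gradient n (x - c) = (- n * norm (x - c) powr (- n - 1)) *\<^sub>R sgn (x - c)"
  proof -
    have "norm (x - c) powr (n + 2) = norm (x - c) powr (n + 1) * norm (x - c)"
      using pos powr_add[of "norm (x - c)" "n + 1" 1] by (simp add: add.commute)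
    then show ?thesis
      using pos powr_minus_divide[of "norm (x - c)" "n + 1"]
      by (simp add: centre_gradient_def sgn_div_norm divide_inverse)
  qed
  moreover have "(\<lambda>x. 1 / norm (x - c) powr n) = (\<lambda>x. norm (x - c) powr (- n))"
    by (simp add: powr_minus_divide)
  ultimately show ?thesis
    using GDERIV_DERIV_compose[OF 1 2] by simp
qed

lemma centre_gradient_minus: "centre_gradient n (- y) = - centre_gradient n y"
  by (simp add: centre_gradient_def)

definition two_centre_gradient :: "real \<Rightarrow> real \<Rightarrow> real^2 \<Rightarrow> real^2 \<Rightarrow> real^2" where
  "two_centre_gradient \<gamma> n r0 x =
     \<gamma> *\<^sub>R (centre_gradient n (x - r0) + centre_gradient n (x + r0))"

lemma two_centre_gradient_minus: "two_centre_gradient \<gamma> n r0 (- x) = - two_centre_gradient \<gamma> n r0 x"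
proof -
  have "- x - r0 = - (x + r0)" "- x + r0 = - (x - r0)" by simp_all
  then show ?thesis
    unfolding two_centre_gradient_def by (simp only: centre_gradient_minus) (simp add: algebra_simps)
qed

text \<open>The exponent condition \<open>n \<ge> 2\<close> enters for \<open>\<rho> < 1\<close>;
  farther out the summand 1 suffices. Multiplied by \<open>\<gamma>\<close>, this summand becomes
  the additive constant of the strong force condition.\<close>

lemma inverse_square_le:
  fixes \<rho> n :: real
  assumes "0 < \<rho>" "2 \<le> n"
  shows "1 / \<rho>\<^sup>2 \<le> 1 / \<rho> powr n + 1"
proof (cases "1 \<le> \<rho>")
  case True
  then have "1 / \<rho>\<^sup>2 \<le> 1" by simp
  then show ?thesis by (simp add: add_increasing)
next
  case False
  then have "\<rho> powr n \<le> \<rho> powr 2" using assms by (intro powr_mono') auto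
  then have "1 / \<rho>\<^sup>2 \<le> 1 / \<rho> powr n" using assms by (simp add: frac_le)
  then show ?thesis by simp
qed

lemma strong_force_two_centre:
  assumes \<gamma>: "0 < \<gamma>" and n: "2 \<le> n"
  shows "strong_force (config_space r0) (\<lambda>x. - potential \<gamma> n r0 x) (two_centre_gradient \<gamma> n r0) \<gamma> \<gamma>"
proof
  show "open (config_space r0)"
    unfolding config_space_def by (intro open_Compl finite_imp_closed) auto
  show "GDERIV (\<lambda>x. - potential \<gamma> n r0 x) x :> two_centre_gradient \<gamma> n r0 x" if "x \<in> config_space r0" for x
  proof -
    have ne: "x \<noteq> r0" "x \<noteq> - r0" using that by (auto simp: config_space_def)
    have "GDERIV (\<lambda>x. 1 / norm (x - r0) powr n + 1 / norm (x - - r0) powr n) x :>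
        centre_gradient n (x - r0) + centre_gradient n (x - - r0)"
      by (intro GDERIV_add GDERIV_inverse_norm_powr ne)
    from GDERIV_mult[OF GDERIV_const[of \<gamma>] this] show ?thesis
      by (simp add: potential_def two_centre_gradient_def)
  qed
  show "continuous_on (config_space r0) (two_centre_gradient \<gamma> n r0)"
    unfolding two_centre_gradient_def centre_gradient_def config_space_def
    by (intro continuous_intros) (auto simp: eq_neg_iff_add_eq_0)
  show "0 \<le> - potential \<gamma> n r0 x" for x
    using \<gamma> by (simp add: potential_def)
  show "\<gamma> / (norm (x - c))\<^sup>2 \<le> - potential \<gamma> n r0 x + \<gamma>"
    if x: "x \<in> config_space r0" and c: "c \<notin> config_space r0" for x c
  proof -
    have c': "c = r0 \<or> c = - r0" and "x \<noteq> c" using x c by (auto simp: config_space_def)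
    then have "1 / (norm (x - c))\<^sup>2 \<le> 1 / norm (x - c) powr n + 1"
      using n by (intro inverse_square_le) auto
    \<comment> \<open>The term of the other centre is nonnegative.\<close>
    also have "\<dots> \<le> (1 / norm (x - r0) powr n + 1 / norm (x + r0) powr n) + 1"
      using c' by auto
    finally have "\<gamma> * (1 / (norm (x - c))\<^sup>2) \<le> \<gamma> * ((1 / norm (x - r0) powr n + 1 / norm (x + r0) powr n) + 1)"
      using \<gamma> by (intro mult_left_mono) auto
    then show ?thesis by (simp add: potential_def algebra_simps)
  qed
qed (rule \<gamma>)

section \<open>The periodic solution\<close>

theorem proposition1:
  fixes \<mu> \<gamma> \<omega> n :: real and r0 :: "real^2" and m :: nat
  assumes "\<mu> > 0" and "\<gamma> > 0" and "r0 \<noteq> 0"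
    and "\<omega> > 0" and "n \<ge> 2" and "m \<ge> 1"
  shows "\<exists>r. is_solution \<mu> (potential \<gamma> n r0) (config_space r0) r \<and>
             (\<forall>t. r (t + \<omega>) = r t) \<and>
             coils r0 m \<omega> r \<and>
             (m = 1 \<longrightarrow> eight_like r0 \<omega> r)"
proof -
  define T where "T = \<omega> / 2"
  have "T > 0" using assms by (simp add: T_def)
  \<comment> \<open>Rescaling the half period \<open>T\<close> to the unit interval divides squared
    velocities by \<open>T\<^sup>2\<close>; then \<open>2 * \<kappa>\<close> times the rescaled
    acceleration is \<open>\<mu>\<close> times the true one.\<close>
  define \<kappa> where "\<kappa> = \<mu> / (2 * T\<^sup>2)"
  have "\<kappa> > 0" using assms \<open>T > 0\<close> by (simp add: \<kappa>_def)
  let ?S = "config_space r0" and ?G = "two_centre_gradient \<gamma> n r0"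
  interpret strong_force ?S "\<lambda>x. - potential \<gamma> n r0 x" ?G \<gamma> \<gamma>
    by (rule strong_force_two_centre) (use assms in auto)
  have \<alpha>: "path (loop_power (alpha_loop r0) m)" "path_image (loop_power (alpha_loop r0) m) \<subseteq> ?S"
    using loop_power_path[OF path_alpha_loop path_image_alpha_loop[OF assms(3)]] by simp_all
  obtain q v where hom: "homotopic_paths ?S (loop_power (alpha_loop r0) m) q"
    and q: "\<And>t. t \<in> {0..1} \<Longrightarrow> (q has_vector_derivative v t) (at t within {0..1})"
    and v: "\<And>t. t \<in> {0..1} \<Longrightarrow> (v has_vector_derivative ?G (q t) /\<^sub>R (2 * \<kappa>)) (at t within {0..1})"
    using strong_force_dirichlet[OF \<alpha> \<open>\<kappa> > 0\<close>] by blast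
  have "pathstart q = 0" "pathfinish q = 0"
    using homotopic_paths_imp_pathstart[OF hom] homotopic_paths_imp_pathfinish[OF hom] by simp_all
  then have q01: "q 0 = 0" "q 1 = 0"
    by (simp_all add: pathstart_def pathfinish_def)
  have qS: "q t \<in> ?S" if "t \<in> {0..1}" for t
    using homotopic_paths_imp_subset[OF hom] that by (auto simp: path_image_def)
  define P where "P = reflect (- 1) q"
  define a where "a t = ?G (q t) /\<^sub>R (2 * \<kappa>)" for t
  \<comment> \<open>The attractions of the two centres cancel at \<open>0\<close>. Hence the
    acceleration of \<open>q\<close> vanishes at both ends, as its odd continuation
    requires.\<close>
  have G0: "?G 0 = 0"
    by (simp add: two_centre_gradient_def centre_gradient_minus)
  have P: "(P has_vector_derivative reflect 1 v s) (at s)" for s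
    unfolding P_def using has_vector_derivative_reflect[OF q, of "- 1" s] q01 by simp
  have V: "(reflect 1 v has_vector_derivative reflect (- 1) a s) (at s)" for s
    using has_vector_derivative_reflect[of v a 1 s] v by (simp add: a_def q01 G0)
  \<comment> \<open>Since the force is odd, reflecting the acceleration gives the force along the
    reflected curve.\<close>
  have aP: "reflect (- 1) a s = ?G (P s) /\<^sub>R (2 * \<kappa>)" for s
    by (simp add: P_def reflect_def a_def two_centre_gradient_minus)
  have PS: "P s \<in> ?S" for s
  proof -
    have "frac s \<in> {0..1}" "1 - frac s \<in> {0..1}"
      using frac_ge_0[of s] frac_lt_1[of s] by auto
    from this[THEN qS] show ?thesis
      by (auto simp: P_def reflect_def config_space_def)
  qed
  define r where "r t = P (t / T)" for t
  have "is_solution \<mu> (potential \<gamma> n r0) ?S r"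
    unfolding is_solution_def
  proof (intro conjI exI allI)
    show "range r \<subseteq> ?S" using PS by (auto simp: r_def)
    show dr: "(r has_vector_derivative reflect 1 v (t / T) /\<^sub>R T) (at t)" for t
      unfolding r_def using P \<open>T > 0\<close> by (intro has_vector_derivative_rescale) auto
    show "((\<lambda>t. reflect 1 v (t / T) /\<^sub>R T) has_vector_derivative ?G (r t) /\<^sub>R \<mu>) (at t)" for t
    proof -
      have "((\<lambda>t. reflect 1 v (t / T)) has_vector_derivative reflect (- 1) a (t / T) /\<^sub>R T) (at t)"
        using V \<open>T > 0\<close> by (intro has_vector_derivative_rescale) auto
      then have "((\<lambda>t. reflect 1 v (t / T) /\<^sub>R T) has_vector_derivative
          (reflect (- 1) a (t / T) /\<^sub>R T) /\<^sub>R T) (at t)"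
        using has_vector_derivative_scaleR[OF DERIV_const] by fastforce
      moreover have "(reflect (- 1) a (t / T) /\<^sub>R T) /\<^sub>R T = ?G (r t) /\<^sub>R \<mu>"
        using \<open>T > 0\<close> by (simp add: aP r_def \<kappa>_def power2_eq_square field_simps)
      ultimately show ?thesis by simp
    qed
    have "continuous_on UNIV r"
      using dr has_vector_derivative_continuous continuous_at_imp_continuous_on by blast
    then show "continuous_on UNIV (\<lambda>t. ?G (r t) /\<^sub>R \<mu>)"
      using PS by (intro continuous_intros continuous_on_compose2[OF continuous_G]) (auto simp: r_def)
    show "GDERIV (potential \<gamma> n r0) (r t) :> (- ?G (r t))" for t
      using GDERIV_minus[OF gradient, of "r t"] PS by (simp add: r_def)
    show "\<mu> *\<^sub>R (?G (r t) /\<^sub>R \<mu>) = - (- ?G (r t))" for t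
      using assms(1) by simp
  qed
  moreover have "\<forall>t. r (t + \<omega>) = r t"
  proof
    fix t
    have "(t + \<omega>) / T = t / T + 2" using \<open>T > 0\<close> by (simp add: T_def field_simps)
    then show "r (t + \<omega>) = r t" by (simp add: r_def P_def reflect_periodic)
  qed
  moreover have coils: "coils r0 m \<omega> r"
  proof -
    have eq: "r (\<omega> * s) = (q +++ (uminus \<circ> reversepath q)) s" if s: "s \<in> {0..1}" for s
    proof -
      have "r (\<omega> * s) = P (2 * s)" using assms(4) by (simp add: r_def T_def mult.commute)
      \<comment> \<open>The break of the joined path at \<open>s = 1/2\<close> is the integer 1 of
        the reflection, so the two halves are its segments 0 and 1.\<close>
      moreover have "P (2 * s) = q (2 * s)" if "s \<le> 1/2"
        using reflect_segment[of "- 1" q "2 * s" 0] that s q01 by (simp add: P_def)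
      moreover have "P (2 * s) = - q (2 - 2 * s)" if "\<not> s \<le> 1/2"
        using reflect_segment[of "- 1" q "2 * s" 1] that s q01 by (simp add: P_def)
      ultimately show ?thesis
        by (simp add: joinpaths_def reversepath_def algebra_simps)
    qed
    have hl: "homotopic_loops ?S (q +++ (uminus \<circ> reversepath q))
        (loop_power (alpha_loop r0) m +++ loop_power (beta_loop r0) m)"
      by (intro odd_double_homotopic assms hom)
    have "homotopic_loops ?S (q +++ (uminus \<circ> reversepath q)) (\<lambda>s. r (\<omega> * s))"
      using homotopic_loops_imp_path[OF hl] homotopic_loops_imp_subset[OF hl]
        homotopic_loops_imp_loop[OF hl] eq
      by (intro homotopic_loops_eq) simp_all
    then show ?thesis
      unfolding coils_def using hl homotopic_loops_sym homotopic_loops_trans by blast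
  qed
  moreover have "m = 1 \<longrightarrow> eight_like r0 \<omega> r"
    using coils by (auto simp: coils_def eight_like_def)
  ultimately show ?thesis by blast
qed

end
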